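(* Let $q$ be a prime power and $n\geq1$. There is a constant $C=C(n,q)>0$ such that for every integer $k>0$, with $R=\mathbb{F}_q[\![t]\!]/t^k\mathbb{F}_q[\![t]\!]$, every function $\phi:R^n\to\mathbb{R}$ and every $\lambda>0$, \[\big|\{w\in S^{n-1}(R):\ \phi^*(w)\geq\lambda\}\big|\leq C\,k^{n+1}\lambda^{-n}\|\phi\|_{\ell^n}^n,\] where $\|\phi\|_{\ell^n}^n=\sum_{v\in R^n}|\phi(v)|^n$.
   Context: $R=\mathbb{F}_q[\![t]\!]/t^k\mathbb{F}_q[\![t]\!]$, a finite ring with $q^k$ elements. $S^{n-1}(R)=R^n\setminus(tR)^n$ is the set of primitive vectors. A line in $R^n$ in the direction of $w\in S^{n-1}(R)$ is a set $\ell=b+Rw$ with $b\in R^n$. For $\phi:R^n\to\mathbb{R}$, $\phi^*:S^{n-1}(R)\to\mathbb{R}$ is $\phi^*(w)=\sup_{\ell}q^{-k}\sum_{v\in\ell}|\phi(v)|$, the supremum over all lines $\ell$ in the direction of $w$. $|\cdot|$ of a finite set denotes its cardinality. *)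

theory Defs
  imports
    "HOL-Library.Cardinality"
    "HOL-Computational_Algebra.Formal_Power_Series"
    "HOL-Number_Theory.Prime_Powers"
    "HOL-Algebra.QuotRing"
    "HOL-Algebra.Algebraic_Closure_Type"
begin

text \<open>
  The finite field with \<open>q\<close> elements is a type \<open>'a\<close> of sort \<open>{field, finite}\<close> with
  \<open>q = CARD('a)\<close>, and \<open>'a fps\<close> is the ring of power series over it. Since the ring
  \<open>R\<close> depends on the number \<open>k\<close>, it is a ring with an explicit carrier, whose elements
  are the cosets of the ideal generated by the \<open>k\<close>-th power of the variable.
\<close>

definition trunc_ideal :: "nat \<Rightarrow> 'a::{field,finite} fps set" where
  "trunc_ideal k = PIdl\<^bsub>ring_of_type_algebra\<^esub> (fps_X ^ k)"

definition trunc_ring :: "nat \<Rightarrow> 'a::{field,finite} fps set ring" where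
  "trunc_ring k = ring_of_type_algebra Quot (trunc_ideal k)"

definition trunc_t :: "nat \<Rightarrow> 'a::{field,finite} fps set" where
  "trunc_t k = trunc_ideal k +>\<^bsub>ring_of_type_algebra\<^esub> fps_X"

text \<open>
  Vectors of length \<open>n\<close> have coordinates indexed by \<open>{..<n}\<close> and are \<open>undefined\<close> at all
  other indices.
\<close>

definition trunc_space :: "nat \<Rightarrow> nat \<Rightarrow> (nat \<Rightarrow> 'a::{field,finite} fps set) set" where
  "trunc_space n k = {..<n} \<rightarrow>\<^sub>E carrier (trunc_ring k)"

definition primitive_vectors :: "nat \<Rightarrow> nat \<Rightarrow> (nat \<Rightarrow> 'a::{field,finite} fps set) set" where
  "primitive_vectors n k =
     trunc_space n k - ({..<n} \<rightarrow>\<^sub>E PIdl\<^bsub>trunc_ring k\<^esub> (trunc_t k))"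

definition trunc_line ::
  "nat \<Rightarrow> nat \<Rightarrow> (nat \<Rightarrow> 'a::{field,finite} fps set) \<Rightarrow> (nat \<Rightarrow> 'a fps set) \<Rightarrow> (nat \<Rightarrow> 'a fps set) set"
  where
  "trunc_line n k b w =
     (\<lambda>r. \<lambda>i\<in>{..<n}. b i \<oplus>\<^bsub>trunc_ring k\<^esub> (r \<otimes>\<^bsub>trunc_ring k\<^esub> w i)) ` carrier (trunc_ring k)"

definition lines_in_direction ::
  "nat \<Rightarrow> nat \<Rightarrow> (nat \<Rightarrow> 'a::{field,finite} fps set) \<Rightarrow> (nat \<Rightarrow> 'a fps set) set set" where
  "lines_in_direction n k w = (\<lambda>b. trunc_line n k b w) ` trunc_space n k"

definition kakeya_maximal ::
  "nat \<Rightarrow> nat \<Rightarrow> ((nat \<Rightarrow> 'a::{field,finite} fps set) \<Rightarrow> real) \<Rightarrow> (nat \<Rightarrow> 'a fps set) \<Rightarrow> real" where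
  "kakeya_maximal n k \<phi> w =
     (SUP l\<in>lines_in_direction n k w. (\<Sum>v\<in>l. \<bar>\<phi> v\<bar>) / real CARD('a) ^ k)"

end

theory Submission
  imports Defs "HOL-Number_Theory.Residues"
begin

text \<open>
  The proof is the polynomial method, with a Carlitz module turning lines over \<open>R\<close> into algebraic curves.
  Over \<open>A = F\<^sub>q[[s]]\<close> there is a \<open>c\<close> in the maximal ideal for which \<open>s\<close> is a generator of the kernel of
  \<open>\<sigma>\<^sup>k\<close>, where \<open>\<sigma>(x) = x\<^sup>q + c x\<close>. Letting \<open>t\<close> act as \<open>\<sigma>\<close> embeds \<open>R\<close> into \<open>A\<close> by \<open>e(r) = r(\<sigma>)(s)\<close>, and the
  line \<open>b + R w\<close> lies on the curve \<open>z \<mapsto> e(b) + w(\<sigma>)(z)\<close>, which modulo \<open>s\<close> is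
  \<open>z \<mapsto> (\<Sum>\<^sub>j w\<^sub>i\<^sub>j z^(q^j))\<^sub>i\<close>, independently of \<open>b\<close>.

  Put a multiplicity \<open>m(v)\<close> proportional to \<open>|\<phi>(v)|\<close> on each point. For a polynomial over \<open>A\<close>,
  vanishing to order \<open>m(v)\<close> at every \<open>e(v)\<close> amounts to at most \<open>\<Sum> m(v)^n\<close> linear conditions. On the curve of
  a direction whose line is heavy such a polynomial is divisible by a monic polynomial congruent to \<open>z^M\<close> modulo \<open>s\<close>, so its reduction
  modulo \<open>s\<close> vanishes to order \<open>M\<close> at \<open>z = 0\<close> along the reduced curve. After normalizing one coordinate of
  the directions to be 1, the reduced curves of distinct directions separate so early that, for
  \<open>M\<close> of size \<open>n k q^k\<close>, these vanishing conditions on the reduction include about \<open>n k q^k\<close> independent ones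
  per direction. Comparing the two counts bounds the number of directions.
\<close>

section \<open>Linear systems, power series and finite fields\<close>

text \<open>Gaussian elimination without division: the pivot variable is eliminated by
  cross-multiplication, so the coefficients may lie in any integral domain.\<close>

lemma homogeneous_system_nontrivial_solution:
  fixes a :: "'i \<Rightarrow> 'v \<Rightarrow> 'b::idom"
  assumes "finite I" "finite V" "card I < card V"
  shows "\<exists>x. (\<exists>v\<in>V. x v \<noteq> 0) \<and> (\<forall>i\<in>I. (\<Sum>v\<in>V. a i v * x v) = 0)"
  using assms
proof (induction I arbitrary: V a rule: finite_induct)
  case empty
  then obtain v where "v \<in> V" by fastforce
  then show ?case by (intro exI[of _ "\<lambda>_. 1"]) auto
next
  case (insert i I)
  show ?case
  proof (cases "\<forall>v\<in>V. a i v = 0")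
    case True
    have "card I < card V" using insert by simp
    from insert.IH[OF insert.prems(1) this, of a]
    obtain x where x: "\<exists>v\<in>V. x v \<noteq> 0" "\<forall>j\<in>I. (\<Sum>v\<in>V. a j v * x v) = 0" by blast
    then show ?thesis using True by (intro exI[of _ x]) auto
  next
    case False
    then obtain p where p: "p \<in> V" "a i p \<noteq> 0" by blast
    define W where "W = V - {p}"
    have W: "finite W" "card I < card W" "p \<notin> W" "V = insert p W"
      using insert p by (auto simp: W_def)
    define a' where "a' j v = a i p * a j v - a j p * a i v" for j v
    from insert.IH[OF W(1,2), of a']
    obtain y where y: "\<exists>v\<in>W. y v \<noteq> 0" "\<And>j. j \<in> I \<Longrightarrow> (\<Sum>v\<in>W. a' j v * y v) = 0" by blast
    \<comment> \<open>The pivot equation is solved for coordinate \<open>p\<close>; scaling the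
      other coordinates by the pivot \<open>a i p\<close> clears the denominator.\<close>
    define x where "x v = (if v = p then - (\<Sum>v\<in>W. a i v * y v) else a i p * y v)" for v
    have sum_x: "(\<Sum>v\<in>V. a j v * x v) = (\<Sum>v\<in>W. a' j v * y v)" for j
    proof -
      have "(\<Sum>v\<in>V. a j v * x v) = a j p * x p + (\<Sum>v\<in>W. a j v * x v)"
        using W by simp
      also have "(\<Sum>v\<in>W. a j v * x v) = (\<Sum>v\<in>W. a j v * (a i p * y v))"
        by (rule sum.cong) (use W in \<open>auto simp: x_def\<close>)
      also have "a j p * x p + \<dots> = (\<Sum>v\<in>W. a' j v * y v)"
        by (simp add: x_def a'_def algebra_simps sum_distrib_left sum_subtractf)
      finally show ?thesis .
    qed
    have "(\<Sum>v\<in>W. a' i v * y v) = 0"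
      by (simp add: a'_def)
    moreover obtain v where "v \<in> W" "y v \<noteq> 0" using y(1) by blast
    hence "v \<in> V" "x v \<noteq> 0" using W p by (auto simp: x_def)
    ultimately show ?thesis
      using sum_x y(2) by (intro exI[of _ x]) auto
  qed
qed

text \<open>Dividing a nonzero solution by the largest power of \<open>fps_X\<close> common to its
  entries keeps it a solution and leaves some entry a unit. A combination formed with these entries
  then has a coefficient that survives reduction modulo the variable.\<close>

lemma fps_homogeneous_system_primitive_solution:
  fixes a :: "'i \<Rightarrow> 'v \<Rightarrow> 'b::field fps"
  assumes "finite I" "finite V" "card I < card V"
  shows "\<exists>x. (\<exists>v\<in>V. fps_nth (x v) 0 \<noteq> 0) \<and> (\<forall>i\<in>I. (\<Sum>v\<in>V. a i v * x v) = 0)"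
proof -
  obtain x where x: "\<exists>v\<in>V. x v \<noteq> 0" "\<And>i. i \<in> I \<Longrightarrow> (\<Sum>v\<in>V. a i v * x v) = 0"
    using homogeneous_system_nontrivial_solution[OF assms, of a] by blast
  define S where "S = subdegree ` x ` {v\<in>V. x v \<noteq> 0}"
  have S: "finite S" "S \<noteq> {}" using assms x(1) by (auto simp: S_def)
  define d where "d = Min S"
  have "d \<in> S" using S by (simp add: d_def)
  then obtain v where v: "v \<in> V" "x v \<noteq> 0" "d = subdegree (x v)" by (auto simp: S_def)
  have x_eq: "x u = fps_X ^ d * fps_shift d (x u)" if "u \<in> V" for u
  proof (cases "x u = 0")
    case False
    then have "d \<le> subdegree (x u)" unfolding d_def using S that by (auto simp: S_def)
    then show ?thesis by (metis fps_shift_times_fps_X_power mult.commute)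
  qed auto
  have "(\<Sum>u\<in>V. a i u * fps_shift d (x u)) = 0" if "i \<in> I" for i
  proof -
    have "fps_X ^ d * (\<Sum>u\<in>V. a i u * fps_shift d (x u)) = (\<Sum>u\<in>V. a i u * x u)"
      unfolding sum_distrib_left
      by (rule sum.cong) (use x_eq in \<open>metis mult.left_commute\<close>)+
    then show ?thesis using x(2)[OF that] by simp
  qed
  moreover have "fps_nth (fps_shift d (x v)) 0 \<noteq> 0" using v by simp
  ultimately show ?thesis using v(1) by (intro exI[of _ "\<lambda>u. fps_shift d (x u)"]) blast
qed

text \<open>The hypothesis says that \<open>F\<close> is a contraction for the adic metric, so the
  iterates starting from 0 stabilize coefficient by coefficient.\<close>

lemma fps_contraction_fixpoint:
  fixes F :: "'b::zero fps \<Rightarrow> 'b fps"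
  assumes "\<And>m f g. \<forall>i<m. fps_nth f i = fps_nth g i \<Longrightarrow> \<forall>i\<le>m. fps_nth (F f) i = fps_nth (F g) i"
  shows "\<exists>f. F f = f"
proof -
  define u where "u n = (F ^^ n) 0" for n
  have step: "\<forall>i<n. fps_nth (u (Suc n)) i = fps_nth (u n) i" for n
  proof (induction n)
    case (Suc n)
    from assms[OF Suc] show ?case by (simp add: u_def less_Suc_eq_le)
  qed auto
  have stable: "fps_nth (u (n + d)) i = fps_nth (u n) i" if "i < n" for n d i
    by (induction d) (use step that in auto)
  define f where "f = Abs_fps (\<lambda>i. fps_nth (u (Suc i)) i)"
  have f: "fps_nth f i = fps_nth (u n) i" if "i < n" for i n
    using stable[of i "Suc i" "n - Suc i"] that by (simp add: f_def)
  \<comment> \<open>The limit \<open>f\<close> agrees with the iterate \<open>u i\<close> below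
    degree \<open>i\<close>, so the hypothesis compares \<open>F f\<close> with
    \<open>u (Suc i)\<close> at degree \<open>i\<close>.\<close>
  have "fps_nth (F f) i = fps_nth f i" for i
    using assms[of i f "u i"] f[of i "Suc i"] f by (auto simp: u_def)
  then show ?thesis by (auto simp: fps_eq_iff)
qed

section \<open>Frobenius on a finite field, and divisibility by powers of linear factors\<close>

lemma power_card_field:
  fixes x :: "'a::{field,finite}"
  shows "x ^ CARD('a) = x"
proof (cases "x = 0")
  case False
  have "(\<Prod>y\<in>UNIV-{0}. y) = (\<Prod>y\<in>UNIV-{0}. x * y)"
    by (rule prod.reindex_bij_witness[of _ "\<lambda>y. x * y" "\<lambda>y. y / x"]) (use False in auto)
  also have "\<dots> = x ^ (CARD('a) - 1) * (\<Prod>y\<in>UNIV-{0}. y)"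
    by (simp add: prod.distrib)
  finally have "x ^ (CARD('a) - 1) = 1" by simp
  then have "x * x ^ (CARD('a) - 1) = x" by simp
  then show ?thesis by (metis power_minus_mult zero_less_card_finite mult.commute)
qed auto

lemma prime_CHAR_finite_field: "Factorial_Ring.prime CHAR('a::{field,finite})"
  using prime_CHAR_semidom finite_imp_CHAR_pos[OF finite] by auto

lemma card_eq_CHAR_power:
  assumes "primepow CARD('a::{field,finite})"
  shows "\<exists>e. CARD('a) = CHAR('a) ^ e"
proof -
  obtain p e where pe: "Factorial_Ring.prime p" "CARD('a) = p ^ e"
    using assms by (auto simp: primepow_def)
  have "CHAR('a) dvd p ^ e" using CHAR_dvd_CARD[where ?'a = 'a] pe by simp
  then have "CHAR('a) = p"
    using prime_CHAR_finite_field[where ?'a = 'a] pe(1) prime_dvd_power primes_dvd_imp_eq by blast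
  then show ?thesis using pe by blast
qed

text \<open>\<open>CARD('a)\<close> is a power of the common characteristic, so the map is an
  iterated Frobenius. This makes the Carlitz operator additive.\<close>

lemma power_card_add:
  fixes x y :: "'b::comm_semiring_1"
  assumes "primepow CARD('a::{field,finite})" "CHAR('b) = CHAR('a)"
  shows "(x + y) ^ CARD('a) = x ^ CARD('a) + y ^ CARD('a)"
  using card_eq_CHAR_power[OF assms(1)] assms(2) prime_CHAR_finite_field[where ?'a = 'a]
  by (metis freshmans_dream')

text \<open>The factors already split off do not vanish at the new root \<open>a r\<close>, so the
  whole order of vanishing there passes to the cofactor.\<close>

lemma prod_linear_powers_dvd:
  fixes f :: "'b::idom poly"
  assumes "finite S" "inj_on a S" "\<And>r. r \<in> S \<Longrightarrow> [:- a r, 1:] ^ m r dvd f"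
  shows "(\<Prod>r\<in>S. [:- a r, 1:] ^ m r) dvd f"
  using assms
proof (induction S rule: finite_induct)
  case (insert r S)
  show ?case
  proof (cases "f = 0")
    case False
    let ?G = "\<Prod>r\<in>S. [:- a r, 1:] ^ m r"
    obtain g where g: "f = ?G * g" using insert by (auto elim: dvdE)
    have "poly ?G (a r) \<noteq> 0"
      using insert.hyps insert.prems(1) by (auto simp: poly_prod inj_on_def)
    then have "Polynomial.order (a r) ?G = 0" by (rule order_0I)
    moreover have "m r \<le> Polynomial.order (a r) f"
      using insert.prems(2)[of r] False by (simp add: order_divides)
    ultimately have "m r \<le> Polynomial.order (a r) g"
      using False g order_mult[of ?G g "a r"] by simp
    then have "[:- a r, 1:] ^ m r dvd g" by (simp add: order_divides)
    then show ?thesis using insert.hyps by (auto simp: g intro: mult_dvd_mono)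
  qed auto
qed auto

section \<open>Torsion of the Carlitz module\<close>

text \<open>Stated for any commutative ring because it acts both on power series and, with the
  constant polynomial \<open>[:c:]\<close> in place of \<open>c\<close>, on polynomials over
  them.\<close>

definition twist :: "nat \<Rightarrow> 'b::comm_ring_1 \<Rightarrow> 'b \<Rightarrow> 'b" where
  "twist q c x = x ^ q + c * x"

lemma twist_zero: "q > 0 \<Longrightarrow> twist q c 0 = 0"
  by (simp add: twist_def power_0_left)

lemma fps_X_power_dvd_iff_nth:
  fixes f :: "'b::comm_ring_1 fps"
  shows "fps_X ^ m dvd f \<longleftrightarrow> (\<forall>i<m. fps_nth f i = 0)"
proof
  assume "fps_X ^ m dvd f"
  then show "\<forall>i<m. fps_nth f i = 0" by (auto elim!: dvdE simp: fps_X_power_mult_nth)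
next
  assume "\<forall>i<m. fps_nth f i = 0"
  then have "fps_cutoff m f = 0" by (auto simp: fps_eq_iff)
  then have "f = fps_X ^ m * fps_shift m f"
    by (metis fps_shift_cutoff' add.right_neutral)
  then show "fps_X ^ m dvd f" by (metis dvd_triv_left)
qed

lemma diff_dvd_power_diff:
  fixes x y :: "'b::comm_ring_1"
  shows "x - y dvd x ^ m - y ^ m"
  by (cases m) (auto simp only: power_diff_sumr2 dvd_triv_left power_0 diff_self dvd_0_right)

text \<open>The \<open>k\<close>-th iterate factors through the previous one, and \<open>c\<close>
  is found as the fixed point that kills the other factor. Changing \<open>c\<close> by a multiple
  of \<open>fps_X ^ m\<close> changes each iterate by a multiple of \<open>fps_X ^ Suc m\<close>,
  because all iterates are divisible by \<open>fps_X\<close>; this is the contraction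
  property.\<close>

lemma twist_torsion_exists:
  fixes q k :: nat
  assumes "q \<ge> 2" "k > 0"
  shows "\<exists>c :: 'b::idom fps. fps_nth c 0 = 0 \<and> (twist q c ^^ k) fps_X = 0
            \<and> (twist q c ^^ (k - 1)) fps_X \<noteq> 0"
proof -
  define S :: "'b fps \<Rightarrow> nat \<Rightarrow> 'b fps" where "S c j = (twist q c ^^ j) fps_X" for c j
  have S_Suc: "S c (Suc j) = S c j ^ q + c * S c j" for c j by (simp add: S_def twist_def)
  have X_dvd: "fps_X dvd S c j" for c j
    by (induction j) (use assms in \<open>auto simp: S_Suc S_def[of _ 0] intro!: dvd_add dvd_trans[OF _ dvd_power]\<close>)
  have S_diff: "fps_X ^ Suc m dvd S c j - S c' j" if "fps_X ^ m dvd c - c'" for c c' m j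
  proof (induction j)
    case (Suc j)
    have "S c (Suc j) - S c' (Suc j)
        = (S c j ^ q - S c' j ^ q) + c * (S c j - S c' j) + (c - c') * S c' j"
      by (simp add: S_Suc algebra_simps)
    moreover have "fps_X ^ Suc m dvd (c - c') * S c' j"
      using mult_dvd_mono[OF X_dvd that] by (metis mult.commute power_Suc)
    ultimately show ?case
      using Suc dvd_trans[OF Suc diff_dvd_power_diff] by (auto intro!: dvd_add)
  qed (simp add: S_def)
  \<comment> \<open>\<open>S c k = S c (k - 1) * (S c (k - 1) ^ (q - 1) + c)\<close>, and the second factor is made to vanish.\<close>
  define F where "F c = - (S c (k - 1) ^ (q - 1))" for c
  have "\<exists>c. F c = c"
  proof (rule fps_contraction_fixpoint)
    fix m and f g :: "'b fps"
    assume "\<forall>i<m. fps_nth f i = fps_nth g i"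
    then have "fps_X ^ m dvd f - g" by (simp add: fps_X_power_dvd_iff_nth)
    then have "fps_X ^ Suc m dvd S f (k - 1) ^ (q - 1) - S g (k - 1) ^ (q - 1)"
      by (rule dvd_trans[OF S_diff diff_dvd_power_diff])
    then show "\<forall>i\<le>m. fps_nth (F f) i = fps_nth (F g) i"
      unfolding fps_X_power_dvd_iff_nth by (auto simp: F_def less_Suc_eq_le)
  qed
  then obtain c where c: "c = - (S c (k - 1) ^ (q - 1))" unfolding F_def by metis
  have "fps_X dvd S c (k - 1) ^ (q - 1)"
    by (rule dvd_trans[OF X_dvd dvd_power]) (use assms in auto)
  then have "fps_X ^ 1 dvd c" by (subst c) simp
  then have c0: "fps_nth c 0 = 0" unfolding fps_X_power_dvd_iff_nth by simp
  have "S c k = S c (k - 1) * (S c (k - 1) ^ (q - 1) + c)"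
    using S_Suc[of c "k - 1"] assms by (simp add: algebra_simps flip: power_Suc)
  then have Sk: "S c k = 0" using c by (metis add.right_inverse mult_zero_right)
  \<comment> \<open>If this iterate vanished, the fixed-point equation would force
    \<open>c = 0\<close>, and the iterates would be the nonzero powers
    \<open>fps_X ^ (q ^ j)\<close>.\<close>
  have "S c (k - 1) \<noteq> 0"
  proof
    assume "S c (k - 1) = 0"
    then have "c = 0" using c assms by (simp add: power_0_left)
    then have "S c j = fps_X ^ (q ^ j)" for j
      by (induction j) (auto simp: S_def[of _ 0] S_Suc power_mult[symmetric] mult.commute)
    then show False using \<open>S c (k - 1) = 0\<close> by simp
  qed
  then show ?thesis using c0 Sk unfolding S_def by blast
qed

section \<open>Constants, ring endomorphisms and reduction modulo the variable\<close>

definition poly_const :: "'a \<Rightarrow> 'a::field fps poly" where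
  "poly_const a = [:fps_const a:]"

text \<open>Applied to two maps, translation of the polynomial variable and reduction of the
  coefficients, so that one lemma moves either of them through the test polynomials.\<close>

definition ring_endo :: "('b::comm_ring_1 \<Rightarrow> 'b) \<Rightarrow> bool" where
  "ring_endo h \<longleftrightarrow> h 1 = 1 \<and> (\<forall>x y. h (x + y) = h x + h y) \<and> (\<forall>x y. h (x * y) = h x * h y)"

lemma ring_endo_simps:
  assumes "ring_endo h"
  shows "h 1 = 1" "h (x + y) = h x + h y" "h (x * y) = h x * h y" "h 0 = 0"
    "h (x - y) = h x - h y" "h (x ^ m) = h x ^ m" "h (sum f A) = (\<Sum>i\<in>A. h (f i))"
    "h (prod f A) = (\<Prod>i\<in>A. h (f i))"
proof -
  show 1: "h 1 = 1" and add: "h (x + y) = h x + h y" and mult: "h (x * y) = h x * h y" for x y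
    using assms by (auto simp: ring_endo_def)
  have "h 0 + h 0 = h 0 + 0" using add[of 0 0] by simp
  then show 0: "h 0 = 0" by (rule add_left_imp_eq)
  have "h (x - y) + h y = h x" for x y using add[of "x - y" y] by simp
  then show "h (x - y) = h x - h y" by (metis add_diff_cancel_right')
  show "h (x ^ m) = h x ^ m" by (induction m) (auto simp: 1 mult)
  show "h (sum f A) = (\<Sum>i\<in>A. h (f i))" by (induction A rule: infinite_finite_induct) (auto simp: 0 add)
  show "h (prod f A) = (\<Prod>i\<in>A. h (f i))" by (induction A rule: infinite_finite_induct) (auto simp: 1 mult)
qed

lemma ring_endo_pcompose: "ring_endo (\<lambda>p :: 'b::comm_ring_1 poly. pcompose p r)"
  by (simp add: ring_endo_def pcompose_1 pcompose_add pcompose_mult)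

text \<open>
  The residue field is embedded back as the constants, so that reduction becomes a ring endomorphism.
\<close>

definition specialize :: "'a::field fps poly \<Rightarrow> 'a fps poly" where
  "specialize = map_poly (\<lambda>a. fps_const (fps_nth a 0))"

lemma coeff_specialize: "Polynomial.coeff (specialize p) i = fps_const (fps_nth (Polynomial.coeff p i) 0)"
  by (simp add: specialize_def coeff_map_poly)

lemma specialize_pCons: "specialize [:a:] = [:fps_const (fps_nth a 0):]"
  by (rule poly_eqI) (simp add: coeff_specialize coeff_pCons split: nat.splits)

lemma specialize_poly_const [simp]: "specialize (poly_const a) = poly_const a"
  by (simp add: specialize_pCons poly_const_def)

lemma specialize_X [simp]: "specialize [:0, 1:] = [:0, 1:]"
  by (rule poly_eqI) (simp add: coeff_specialize coeff_pCons split: nat.splits)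

lemma ring_endo_specialize: "ring_endo specialize"
  unfolding ring_endo_def
proof (intro conjI allI)
  show "specialize (1 :: 'a fps poly) = 1"
    using specialize_pCons[of "1 :: 'a fps"] by (simp add: one_pCons)
  fix p r :: "'a fps poly"
  show "specialize (p + r) = specialize p + specialize r"
    by (rule poly_eqI) (simp add: coeff_specialize)
  have nth_sum: "fps_const (fps_nth (sum f A) 0) = (\<Sum>i\<in>A. fps_const (fps_nth (f i) 0))"
    for f :: "nat \<Rightarrow> 'a fps" and A
    by (induction A rule: infinite_finite_induct) (auto simp: fps_sum_nth simp flip: fps_const_add)
  show "specialize (p * r) = specialize p * specialize r"
    by (rule poly_eqI) (simp add: coeff_specialize coeff_mult nth_sum)
qed

text \<open>
  The reduction of \<open>z \<mapsto> f(\<sigma>)(z)\<close>.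
\<close>

definition lin_poly :: "nat \<Rightarrow> 'a::{field,finite} fps \<Rightarrow> 'a fps poly \<Rightarrow> 'a fps poly" where
  "lin_poly k f Z = (\<Sum>j<k. poly_const (fps_nth f j) * Z ^ (CARD('a) ^ j))"

lemma poly_const_add: "poly_const (a + b) = poly_const a + poly_const b"
  by (simp add: poly_const_def)

lemma poly_const_mult: "poly_const (a * b) = poly_const a * poly_const b"
  by (simp add: poly_const_def)

lemma poly_const_0: "poly_const 0 = 0"
  by (simp add: poly_const_def)

lemma poly_const_diff: "poly_const (a - b) = poly_const a - poly_const b"
  by (simp add: poly_const_def)

lemma poly_const_sum: "poly_const (sum f A) = (\<Sum>i\<in>A. poly_const (f i))"
  by (induction A rule: infinite_finite_induct) (auto simp: poly_const_0 poly_const_add)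

lemma lin_poly_diff: "lin_poly k (f - g) Z = lin_poly k f Z - lin_poly k g Z"
  by (simp add: lin_poly_def poly_const_diff algebra_simps sum_subtractf)

lemma ring_endo_lin_poly:
  assumes "ring_endo h" "\<And>a. h (poly_const a) = poly_const a"
  shows "h (lin_poly k f Z) = lin_poly k f (h Z)"
  using assms by (simp add: lin_poly_def ring_endo_simps)

section \<open>The Carlitz action and its torsion points\<close>

locale carlitz =
  fixes k :: nat and c :: "'a::{field,finite} fps"
  assumes primepow_card: "primepow CARD('a)"
    and k_pos: "k > 0"
    and c_nth_0: "fps_nth c 0 = 0"
    and torsion: "(twist CARD('a) c ^^ k) fps_X = 0"
    and not_torsion: "(twist CARD('a) c ^^ (k - 1)) fps_X \<noteq> 0"
begin

definition sig :: "'a fps poly \<Rightarrow> 'a fps poly" where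
  "sig = twist CARD('a) [:c:]"

text \<open>Substitutes \<open>sig\<close> for the variable of \<open>f\<close>, keeping the first
  \<open>k\<close> terms. At \<open>[:0, 1:]\<close> it gives the curve of a direction, and at a
  torsion point it is the multiplication of the quotient ring.\<close>

definition act :: "'a fps \<Rightarrow> 'a fps poly \<Rightarrow> 'a fps poly" where
  "act f Z = (\<Sum>j<k. poly_const (fps_nth f j) * (sig ^^ j) Z)"

text \<open>The embedding \<open>e\<close> of the overview, valued in constant polynomials so that a
  torsion point can be added to a curve.\<close>

definition tors :: "'a fps \<Rightarrow> 'a fps poly" where
  "tors f = act f [:fps_X:]"

lemma sig_add: "sig (Y + Z) = sig Y + sig Z"
  unfolding sig_def twist_def
  by (subst power_card_add[OF primepow_card]) (auto simp: algebra_simps smult_add_right)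

lemma sig_zero: "sig 0 = 0"
  by (simp add: sig_def twist_zero)

lemma poly_const_power_card: "poly_const a ^ CARD('a) = poly_const (a :: 'a)"
proof -
  have "poly_const a ^ m = poly_const (a ^ m)" for m
    by (induction m) (simp add: poly_const_def one_pCons, simp add: poly_const_mult)
  then show ?thesis by (simp add: power_card_field)
qed

lemma sig_poly_const_mult: "sig (poly_const a * Z) = poly_const a * sig Z"
  by (simp add: sig_def twist_def power_mult_distrib poly_const_power_card algebra_simps)

lemma sig_pow_add: "(sig ^^ j) (Y + Z) = (sig ^^ j) Y + (sig ^^ j) Z"
  by (induction j) (auto simp: sig_add)

lemma sig_pow_zero: "(sig ^^ j) 0 = 0"
  by (induction j) (auto simp: sig_zero)

lemma sig_pow_poly_const_mult: "(sig ^^ j) (poly_const a * Z) = poly_const a * (sig ^^ j) Z"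
  by (induction j) (auto simp: sig_poly_const_mult)

lemma sig_pow_sum: "(sig ^^ j) (sum F A) = (\<Sum>i\<in>A. (sig ^^ j) (F i))"
  by (induction A rule: infinite_finite_induct) (auto simp: sig_pow_zero sig_pow_add)

lemma sig_pow_const: "(sig ^^ j) [:x:] = [:(twist CARD('a) c ^^ j) x:]"
proof (induction j)
  case (Suc j)
  have pow: "[:y:] ^ m = [:y ^ m:]" for y :: "'a fps" and m
    by (induction m) (auto simp: one_pCons)
  show ?case unfolding funpow.simps o_def Suc by (simp add: sig_def twist_def pow)
qed auto

lemma sig_pow_X_eq_0: "j \<ge> k \<Longrightarrow> (sig ^^ j) [:fps_X:] = 0"
proof -
  assume "j \<ge> k"
  then have "(sig ^^ j) [:fps_X:] = (sig ^^ (j - k)) ((sig ^^ k) [:fps_X:])"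
    by (metis comp_apply funpow_add le_add_diff_inverse2)
  then show ?thesis by (simp add: sig_pow_const torsion sig_pow_zero)
qed

lemma act_add: "act f (Y + Z) = act f Y + act f Z"
  by (simp add: act_def sig_pow_add algebra_simps sum.distrib)

lemma act_zero: "act f 0 = 0"
  by (simp add: act_def sig_pow_zero)

lemma act_const: "\<exists>y. act f [:x:] = [:y:]"
  unfolding act_def sig_pow_const poly_const_def
  by (rule exI[of _ "\<Sum>j<k. fps_const (fps_nth f j) * (twist CARD('a) c ^^ j) x"], induction k)
     (auto simp: mult.commute)

lemma tors_add: "tors (f + g) = tors f + tors g"
  by (simp add: tors_def act_def poly_const_add algebra_simps sum.distrib)

lemma tors_diff: "tors (f - g) = tors f - tors g"
  by (simp add: tors_def act_def poly_const_diff algebra_simps sum_subtractf)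

lemma tors_cong: "(\<And>i. i < k \<Longrightarrow> fps_nth f i = fps_nth g i) \<Longrightarrow> tors f = tors g"
  by (simp add: tors_def act_def)

text \<open>Torsion kills the terms of the double sum with \<open>i + j >= k\<close>, and what
  remains is the Cauchy product. With \<open>act_add\<close>, shifting the curve parameter by
  \<open>tors r\<close> becomes a shift of the base point by \<open>r\<close> times the
  direction.\<close>

lemma act_tors: "act f (tors g) = tors (f * g)"
proof -
  let ?s = "\<lambda>j. (sig ^^ j) [:fps_X:]"
  define t where "t i j = poly_const (fps_nth f i) * poly_const (fps_nth g j) * ?s (i + j)" for i j
  have "act f (tors g) = (\<Sum>i<k. \<Sum>j<k. t i j)"
    unfolding act_def tors_def sig_pow_sum sig_pow_poly_const_mult t_def
    by (simp add: sum_distrib_left mult.assoc funpow_add)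
  also have "\<dots> = (\<Sum>(i,j)\<in>{..<k}\<times>{..<k}. t i j)"
    by (simp add: sum.cartesian_product)
  also have "\<dots> = (\<Sum>(i,j)\<in>{(i,j). i + j < k}. t i j)"
    by (rule sum.mono_neutral_right) (auto simp: t_def intro!: sig_pow_X_eq_0)
  also have "\<dots> = (\<Sum>l<k. \<Sum>i\<le>l. t i (l - i))"
    by (rule sum.triangle_reindex)
  also have "\<dots> = tors (f * g)"
    unfolding tors_def act_def
    by (intro sum.cong refl)
       (simp add: t_def fps_mult_nth poly_const_sum poly_const_mult sum_distrib_right atMost_atLeast0)
  finally show ?thesis .
qed

text \<open>If \<open>l\<close> is the lowest index of a nonzero coefficient, multiplication by
  \<open>fps_X ^ (k - 1 - l)\<close> leaves a single term, a nonzero multiple of the iterate in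
  \<open>not_torsion\<close>. This makes the embedding injective.\<close>

lemma tors_nonzero:
  assumes "i < k" "fps_nth f i \<noteq> 0"
  shows "tors f \<noteq> 0"
proof
  assume "tors f = 0"
  define l where "l = (LEAST i. fps_nth f i \<noteq> 0)"
  have l: "fps_nth f l \<noteq> 0" "\<And>j. j < l \<Longrightarrow> fps_nth f j = 0" "l < k"
    using LeastI[of "\<lambda>i. fps_nth f i \<noteq> 0", OF assms(2)]
      Least_le[of "\<lambda>i. fps_nth f i \<noteq> 0", OF assms(2)] not_less_Least assms(1)
    by (auto simp: l_def)
  have "0 = tors (fps_X ^ (k - 1 - l) * f)"
    by (simp add: \<open>tors f = 0\<close> act_zero flip: act_tors)
  also have "\<dots> = (\<Sum>j<k. if j = k - 1 then poly_const (fps_nth f l) * (sig ^^ (k - 1)) [:fps_X:] else 0)"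
    unfolding tors_def act_def
  proof (intro sum.cong refl)
    fix j assume "j \<in> {..<k}"
    then show "poly_const (fps_nth (fps_X ^ (k - 1 - l) * f) j) * (sig ^^ j) [:fps_X:]
        = (if j = k - 1 then poly_const (fps_nth f l) * (sig ^^ (k - 1)) [:fps_X:] else 0)"
      using l by (cases "j = k - 1") (auto simp: fps_X_power_mult_nth poly_const_0)
  qed
  also have "\<dots> = poly_const (fps_nth f l) * (sig ^^ (k - 1)) [:fps_X:]"
    using k_pos by simp
  also have "\<dots> \<noteq> 0"
    using l(1) not_torsion by (simp add: sig_pow_const poly_const_def)
  finally show False by simp
qed

lemma ring_endo_act:
  assumes "ring_endo h" "\<And>a. h (poly_const a) = poly_const a" "h [:c:] = [:c:]"
  shows "h (act f Z) = act f (h Z)"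
proof -
  have "h ((sig ^^ j) Z) = (sig ^^ j) (h Z)" for j
    by (induction j) (auto simp: sig_def twist_def ring_endo_simps[OF assms(1)] assms(3) simp del: mult_pCons_left)
  then show ?thesis by (simp add: act_def ring_endo_simps[OF assms(1)] assms(2))
qed

text \<open>Since \<open>c\<close> has no constant term, reduction turns \<open>sig\<close> into the
  plain \<open>CARD('a)\<close>-th power.\<close>

lemma specialize_act: "specialize (act f Z) = lin_poly k f (specialize Z)"
proof -
  have c: "specialize (Polynomial.smult c p) = 0" for p
    by (rule poly_eqI) (simp add: coeff_specialize c_nth_0)
  have "specialize ((sig ^^ j) Z) = specialize Z ^ (CARD('a) ^ j)" for j
    by (induction j)
       (auto simp: sig_def twist_def ring_endo_simps[OF ring_endo_specialize] c power_mult[symmetric] mult.commute)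
  then show ?thesis
    by (simp add: act_def lin_poly_def ring_endo_simps[OF ring_endo_specialize])
qed

text \<open>The generator \<open>fps_X\<close> reduces to 0, so all embedded points collapse to the
  origin. Hence a reduced curve does not remember its base point.\<close>

lemma specialize_tors: "specialize (tors f) = 0"
  by (simp add: tors_def specialize_act specialize_pCons lin_poly_def power_0_left)

text \<open>The displacement along a curve vanishes at parameter 0, which is the condition that
  \<open>has_jet\<close> puts on \<open>h\<close>.\<close>

lemma X_dvd_act_X: "[:0, 1:] dvd act f [:0, 1:]"
proof -
  have "[:0, 1:] dvd (sig ^^ j) [:0, 1:]" for j
    by (induction j)
       (auto simp: sig_def twist_def intro!: dvd_add dvd_trans[OF _ dvd_power] intro: dvd_mult simp del: mult_pCons_left)
  then show ?thesis by (auto simp: act_def intro!: dvd_sum dvd_mult)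
qed

end

section \<open>Jets and test polynomials\<close>

abbreviation exponent_box :: "nat \<Rightarrow> nat \<Rightarrow> (nat \<Rightarrow> nat) set" where
  "exponent_box n m \<equiv> {..<n} \<rightarrow>\<^sub>E {..<m}"

text \<open>
  Working with exponents in the box \<open>{0..<m}^n\<close> rather than with total degree less than \<open>m\<close> costs only a constant factor
  in the number of conditions.
\<close>

definition has_jet :: "nat \<Rightarrow> nat \<Rightarrow> ((nat \<Rightarrow> 'b::comm_ring_1 poly) \<Rightarrow> 'b poly) \<Rightarrow> ((nat \<Rightarrow> nat) \<Rightarrow> 'b) \<Rightarrow> bool"
  where "has_jet n m F t \<longleftrightarrow> (\<forall>h. (\<forall>i<n. [:0, 1:] dvd h i) \<longrightarrow>
     [:0, 1:] ^ m dvd F h - (\<Sum>\<beta>\<in>exponent_box n m. [:t \<beta>:] * (\<Prod>i<n. h i ^ \<beta> i)))"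

lemma finite_exponent_box [simp]: "finite (exponent_box n m)"
  by (simp add: finite_PiE)

text \<open>A monomial in the box is its own jet. Outside the box some exponent is at least
  \<open>m\<close>, and that coordinate alone contributes the factor \<open>[:0, 1:] ^ m\<close>, so
  the jet is zero.\<close>

lemma has_jet_monomial:
  fixes c :: "'b::comm_ring_1"
  assumes "\<alpha> \<in> {..<n} \<rightarrow>\<^sub>E UNIV"
  shows "\<exists>t. has_jet n m (\<lambda>h. [:c:] * (\<Prod>i<n. h i ^ \<alpha> i)) t"
proof (cases "\<alpha> \<in> exponent_box n m")
  case True
  have "(\<Sum>\<beta>\<in>exponent_box n m. [:if \<beta> = \<alpha> then c else 0:] * (\<Prod>i<n. h i ^ \<beta> i))
      = [:c:] * (\<Prod>i<n. h i ^ \<alpha> i)" for h :: "nat \<Rightarrow> 'b poly"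
    using True by (subst sum.remove[of _ \<alpha>]) (auto intro!: sum.neutral)
  then show ?thesis unfolding has_jet_def by (intro exI[of _ "\<lambda>\<beta>. if \<beta> = \<alpha> then c else 0"]) auto
next
  case False
  then obtain j where j: "j < n" "m \<le> \<alpha> j" using assms by (auto simp: PiE_iff)
  have "[:0, 1:] ^ m dvd (\<Prod>i<n. h i ^ \<alpha> i)" if "\<forall>i<n. [:0, 1:] dvd h i" for h :: "nat \<Rightarrow> 'b poly"
  proof -
    have "[:0, 1:] ^ m dvd h j ^ m" using that j by (auto intro: dvd_power_same)
    also have "\<dots> dvd h j ^ \<alpha> j" using j by (auto intro: le_imp_power_dvd)
    also have "\<dots> dvd (\<Prod>i<n. h i ^ \<alpha> i)" using j by (auto intro: dvd_prodI)
    finally show ?thesis .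
  qed
  then show ?thesis unfolding has_jet_def
    by (intro exI[of _ "\<lambda>_. 0"]) (auto intro: dvd_smult)
qed

lemma has_jet_const: "\<exists>t. has_jet n m (\<lambda>h. [:c:]) t"
  using has_jet_monomial[of "\<lambda>i\<in>{..<n}. 0" n m c] by simp

lemma has_jet_coord:
  assumes "i < n"
  shows "\<exists>t. has_jet n m (\<lambda>h :: nat \<Rightarrow> 'b::comm_ring_1 poly. h i) t"
proof -
  have "(\<Prod>j<n. h j ^ (\<lambda>j\<in>{..<n}. if j = i then 1 else 0) j) = h i" for h :: "nat \<Rightarrow> 'b poly"
    using assms by (subst prod.remove[of _ i]) (auto intro!: prod.neutral)
  then show ?thesis
    using has_jet_monomial[of "\<lambda>j\<in>{..<n}. if j = i then 1 else 0" n m "1 :: 'b"]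
    by (simp add: pCons_one)
qed

lemma has_jet_add:
  assumes "has_jet n m F t" "has_jet n m G u"
  shows "has_jet n m (\<lambda>h. F h + G h) (\<lambda>\<beta>. t \<beta> + u \<beta>)"
  unfolding has_jet_def
proof (intro allI impI)
  fix h :: "nat \<Rightarrow> 'a poly" assume h: "\<forall>i<n. [:0, 1:] dvd h i"
  have "(F h + G h) - (\<Sum>\<beta>\<in>exponent_box n m. [:t \<beta> + u \<beta>:] * (\<Prod>i<n. h i ^ \<beta> i))
    = (F h - (\<Sum>\<beta>\<in>exponent_box n m. [:t \<beta>:] * (\<Prod>i<n. h i ^ \<beta> i)))
    + (G h - (\<Sum>\<beta>\<in>exponent_box n m. [:u \<beta>:] * (\<Prod>i<n. h i ^ \<beta> i)))"
    by (simp add: smult_add_left sum.distrib)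
  then show "[:0, 1:] ^ m dvd (F h + G h) - (\<Sum>\<beta>\<in>exponent_box n m. [:t \<beta> + u \<beta>:] * (\<Prod>i<n. h i ^ \<beta> i))"
    using assms h unfolding has_jet_def by (metis (no_types, lifting) dvd_add)
qed

text \<open>Jets multiply as polynomials; products whose exponent leaves the box are dropped, being
  divisible by \<open>[:0, 1:] ^ m\<close>.\<close>

lemma has_jet_mult:
  assumes "has_jet n m F t" "has_jet n m G u"
  shows "\<exists>v. has_jet n m (\<lambda>h. F h * G h) v"
proof -
  let ?B = "exponent_box n m"
  let ?D = "?B \<times> ?B"
  define s where "s = (\<lambda>(\<beta>, \<gamma>). \<lambda>i\<in>{..<n}. \<beta> i + \<gamma> i :: nat)"
  define v where "v \<delta> = (\<Sum>p | p \<in> {p\<in>?D. s p \<in> ?B} \<and> s p = \<delta>. t (fst p) * u (snd p))" for \<delta>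
  have fin: "finite ?D" by auto
  have "[:0, 1:] ^ m dvd F h * G h - (\<Sum>\<beta>\<in>?B. [:v \<beta>:] * (\<Prod>i<n. h i ^ \<beta> i))"
    if h: "\<forall>i<n. [:0, 1:] dvd h i" for h :: "nat \<Rightarrow> 'a poly"
  proof -
    define mon where "mon \<beta> = (\<Prod>i<n. h i ^ \<beta> i)" for \<beta> :: "nat \<Rightarrow> nat"
    define St where "St = (\<Sum>\<beta>\<in>?B. [:t \<beta>:] * mon \<beta>)"
    define Su where "Su = (\<Sum>\<beta>\<in>?B. [:u \<beta>:] * mon \<beta>)"
    define w where "w p = [:t (fst p) * u (snd p):] * mon (s p)" for p
    have F: "[:0, 1:] ^ m dvd F h - St" and G: "[:0, 1:] ^ m dvd G h - Su"
      using assms h by (auto simp: has_jet_def St_def Su_def mon_def)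
    have mon_s: "mon (s (\<beta>, \<gamma>)) = mon \<beta> * mon \<gamma>" for \<beta> \<gamma>
      by (simp add: mon_def s_def power_add prod.distrib)
    have "St * Su = (\<Sum>\<beta>\<in>?B. \<Sum>\<gamma>\<in>?B. w (\<beta>, \<gamma>))"
      unfolding St_def Su_def sum_product
      by (intro sum.cong refl) (simp add: w_def mon_s mult_ac)
    also have "\<dots> = (\<Sum>p\<in>?D. w p)"
      by (simp add: sum.cartesian_product)
    also have "\<dots> = (\<Sum>p\<in>{p\<in>?D. s p \<in> ?B}. w p) + (\<Sum>p\<in>?D - {p\<in>?D. s p \<in> ?B}. w p)"
      by (subst sum.subset_diff[of "{p\<in>?D. s p \<in> ?B}"]) (use fin in \<open>auto simp: add.commute\<close>)
    also have "(\<Sum>p\<in>{p\<in>?D. s p \<in> ?B}. w p) = (\<Sum>\<delta>\<in>?B. \<Sum>p | p \<in> {p\<in>?D. s p \<in> ?B} \<and> s p = \<delta>. w p)"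
      by (rule sum.group[symmetric]) (use fin in auto)
    also have "\<dots> = (\<Sum>\<delta>\<in>?B. [:v \<delta>:] * mon \<delta>)"
    proof (intro sum.cong refl)
      fix \<delta> assume "\<delta> \<in> ?B"
      have hom: "[:sum f A:] = (\<Sum>x\<in>A. [:f x:])" for f :: "(nat \<Rightarrow> nat) \<times> (nat \<Rightarrow> nat) \<Rightarrow> 'a" and A
        by (rule poly_eqI) (simp add: coeff_sum coeff_pCons split: nat.split)
      show "(\<Sum>p | p \<in> {p\<in>?D. s p \<in> ?B} \<and> s p = \<delta>. w p) = [:v \<delta>:] * mon \<delta>"
        unfolding v_def hom sum_distrib_right by (rule sum.cong) (auto simp: w_def)
    qed
    finally have prod_eq: "St * Su = (\<Sum>\<delta>\<in>?B. [:v \<delta>:] * mon \<delta>) + (\<Sum>p\<in>?D - {p\<in>?D. s p \<in> ?B}. w p)" .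
    have "[:0, 1:] ^ m dvd (\<Sum>p\<in>?D - {p\<in>?D. s p \<in> ?B}. w p)"
    proof (rule dvd_sum)
      fix p assume p: "p \<in> ?D - {p\<in>?D. s p \<in> ?B}"
      then have "s p \<notin> ?B" by auto
      moreover have "s p \<in> {..<n} \<rightarrow>\<^sub>E UNIV" by (auto simp: s_def split: prod.splits)
      ultimately obtain j where j: "j < n" "m \<le> s p j" by (auto simp: PiE_iff)
      have "[:0, 1:] ^ m dvd h j ^ m" using h j by (auto intro: dvd_power_same)
      also have "\<dots> dvd h j ^ s p j" using j by (auto intro: le_imp_power_dvd)
      also have "\<dots> dvd mon (s p)" unfolding mon_def using j by (auto intro: dvd_prodI)
      finally show "[:0, 1:] ^ m dvd w p" unfolding w_def by (rule dvd_mult)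
    qed
    moreover have "F h * G h - St * Su = (F h - St) * G h + St * (G h - Su)"
      by (simp add: algebra_simps)
    then have "[:0, 1:] ^ m dvd F h * G h - St * Su" using F G by (simp add: dvd_add)
    ultimately have "[:0, 1:] ^ m dvd (F h * G h - St * Su) + (\<Sum>p\<in>?D - {p\<in>?D. s p \<in> ?B}. w p)"
      by (simp add: dvd_add)
    then show ?thesis unfolding prod_eq mon_def by simp
  qed
  then show ?thesis unfolding has_jet_def by blast
qed

lemma has_jet_sum:
  assumes "finite A" "\<And>x. x \<in> A \<Longrightarrow> \<exists>t. has_jet n m (F x) t"
  shows "\<exists>t. has_jet n m (\<lambda>h. \<Sum>x\<in>A. F x h) t"
  using assms
proof (induction A rule: finite_induct)
  case empty
  show ?case using has_jet_const[of n m 0] by simp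
next
  case (insert x A)
  then obtain t u where "has_jet n m (F x) t" "has_jet n m (\<lambda>h. \<Sum>x\<in>A. F x h) u" by blast
  from has_jet_add[OF this] show ?case using insert by auto
qed

lemma has_jet_prod:
  assumes "finite A" "\<And>x. x \<in> A \<Longrightarrow> \<exists>t. has_jet n m (F x) t"
  shows "\<exists>t. has_jet n m (\<lambda>h. \<Prod>x\<in>A. F x h) t"
  using assms
proof (induction A rule: finite_induct)
  case empty
  show ?case using has_jet_const[of n m 1] by (simp add: pCons_one)
next
  case (insert x A)
  then obtain t u where "has_jet n m (F x) t" "has_jet n m (\<lambda>h. \<Prod>x\<in>A. F x h) u" by blast
  from has_jet_mult[OF this] show ?case using insert by auto
qed

lemma has_jet_power:
  assumes "\<exists>t. has_jet n m F t"
  shows "\<exists>t. has_jet n m (\<lambda>h. F h ^ e) t"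
  using has_jet_prod[of "{..<e}" n m "\<lambda>_. F"] assms by simp

lemma has_jet_diff:
  fixes F G :: "(nat \<Rightarrow> 'b::comm_ring_1 poly) \<Rightarrow> 'b poly"
  assumes "\<exists>t. has_jet n m F t" "\<exists>t. has_jet n m G t"
  shows "\<exists>t. has_jet n m (\<lambda>h. F h - G h) t"
proof -
  obtain t u v where t: "has_jet n m F t" and u: "has_jet n m G u" and v: "has_jet n m (\<lambda>h. [:-1 :: 'b:]) v"
    using assms has_jet_const[of n m "-1 :: 'b"] by blast
  from has_jet_mult[OF v u] obtain x where "has_jet n m (\<lambda>h. [:-1:] * G h) x" by blast
  from has_jet_add[OF t this] show ?thesis by auto
qed

section \<open>Truncated power series as representatives of the quotient ring, and their
  count\<close>

definition trunc_fps :: "nat \<Rightarrow> 'a::zero fps set" where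
  "trunc_fps k = {f. \<forall>i\<ge>k. fps_nth f i = 0}"

lemma trunc_fps_vanishing_card:
  fixes k l :: nat
  defines "S \<equiv> {f \<in> trunc_fps k :: 'a::{zero,finite} fps set. \<forall>i<l. fps_nth f i = 0}"
  shows "finite S" "card S \<le> CARD('a) ^ (k - l)"
proof -
  let ?r = "\<lambda>f :: 'a fps. restrict (fps_nth f) {l..<k}"
  have inj: "inj_on ?r S"
  proof (rule inj_onI)
    fix f g assume fg: "f \<in> S" "g \<in> S" "?r f = ?r g"
    have "fps_nth f i = fps_nth g i" for i
    proof (cases "l \<le> i \<and> i < k")
      case True
      then show ?thesis using fun_cong[OF fg(3), of i] by simp
    qed (use fg in \<open>auto simp: S_def trunc_fps_def\<close>)
    then show "f = g" by (simp add: fps_eq_iff)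
  qed
  have sub: "?r ` S \<subseteq> {l..<k} \<rightarrow>\<^sub>E UNIV" by auto
  have fin: "finite ({l..<k} \<rightarrow>\<^sub>E (UNIV :: 'a set))" by (simp add: finite_PiE)
  show "finite S" using inj_on_finite[OF inj sub fin] .
  show "card S \<le> CARD('a) ^ (k - l)"
    using card_inj_on_le[OF inj sub fin] by (simp add: card_PiE)
qed

lemma finite_trunc_fps: "finite (trunc_fps k :: 'a::{zero,finite} fps set)"
  using trunc_fps_vanishing_card(1)[of k 0] by simp

lemma card_trunc_fps_le: "card (trunc_fps k :: 'a::{zero,finite} fps set) \<le> CARD('a) ^ k"
  using trunc_fps_vanishing_card(2)[of k 0] by simp

lemma trunc_fps_diff: "f \<in> trunc_fps k \<Longrightarrow> g \<in> trunc_fps k \<Longrightarrow> f - g \<in> trunc_fps k"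
  for f g :: "'a::group_add fps"
  by (simp add: trunc_fps_def)

lemma fps_cutoff_in_trunc_fps [simp]: "fps_cutoff k f \<in> trunc_fps k"
  by (simp add: trunc_fps_def)

lemma subdegree_less_trunc_fps: "f \<in> trunc_fps k \<Longrightarrow> f \<noteq> 0 \<Longrightarrow> subdegree f < k"
  unfolding trunc_fps_def using nth_subdegree_nonzero not_less by blast

text \<open>At most \<open>CARD('a) ^ (k - l)\<close> series have subdegree \<open>l\<close>, each
  contributing \<open>CARD('a) ^ l\<close>, so each of the \<open>k\<close> layers contributes at
  most \<open>CARD('a) ^ k\<close>.\<close>

lemma sum_card_power_subdegree_le:
  "(\<Sum>f\<in>trunc_fps k - {0 :: 'a::{field,finite} fps}. CARD('a) ^ subdegree f) \<le> k * CARD('a) ^ k"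
proof -
  let ?T = "trunc_fps k - {0 :: 'a fps}"
  have "(\<Sum>f\<in>?T. CARD('a) ^ subdegree f)
      = (\<Sum>l<k. \<Sum>f | f \<in> ?T \<and> subdegree f = l. CARD('a) ^ subdegree f)"
    by (rule sum.group[symmetric]) (auto simp: finite_trunc_fps intro: subdegree_less_trunc_fps)
  also have "\<dots> \<le> (\<Sum>l<k. CARD('a) ^ k)"
  proof (rule sum_mono)
    fix l assume l: "l \<in> {..<k}"
    have "card {f \<in> ?T. subdegree f = l}
        \<le> card {f \<in> trunc_fps k :: 'a fps set. \<forall>i<l. fps_nth f i = 0}"
      by (rule card_mono) (auto intro: trunc_fps_vanishing_card)
    also have "\<dots> \<le> CARD('a) ^ (k - l)" by (rule trunc_fps_vanishing_card)
    finally have "card {f \<in> ?T. subdegree f = l} * CARD('a) ^ l \<le> CARD('a) ^ (k - l) * CARD('a) ^ l"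
      by simp
    also have "\<dots> = CARD('a) ^ k" using l by (simp flip: power_add)
    finally show "(\<Sum>f | f \<in> ?T \<and> subdegree f = l. CARD('a) ^ subdegree f) \<le> CARD('a) ^ k"
      by simp
  qed
  finally show ?thesis by simp
qed

text \<open>
  Restricted to the reduced curve of a direction \<open>w'\<close> with \<open>w' i0 = 1\<close>, this vanishes unless \<open>w' = w\<close>.
\<close>

definition test_poly ::
  "nat \<Rightarrow> nat \<Rightarrow> nat \<Rightarrow> (nat \<Rightarrow> 'a::{field,finite} fps) \<Rightarrow> nat \<Rightarrow> (nat \<Rightarrow> 'a fps poly) \<Rightarrow> 'a fps poly"
  where "test_poly k n i0 w e Y =
    Y i0 ^ e * (\<Prod>j\<in>{..<n} - {i0}. \<Prod>u\<in>trunc_fps k - {w j}. Y j - lin_poly k u (Y i0))"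

lemma ring_endo_test_poly:
  assumes "ring_endo h" "\<And>a. h (poly_const a) = poly_const a"
  shows "h (test_poly k n i0 w e Y) = test_poly k n i0 w e (\<lambda>i. h (Y i))"
  by (simp add: test_poly_def ring_endo_simps[OF assms(1)] ring_endo_lin_poly[OF assms])

lemma test_poly_cong:
  assumes "i0 < n" "\<And>i. i < n \<Longrightarrow> Y i = Z i"
  shows "test_poly k n i0 w e Y = test_poly k n i0 w e Z"
  using assms by (simp add: test_poly_def)

text \<open>A test polynomial is assembled from shifted coordinates by sums, differences, products
  and powers, and having a jet is preserved by all of these. The jet entries at a point supply the
  coefficients of the linear conditions there.\<close>

lemma has_jet_test_poly:
  assumes "i0 < n"
  shows "\<exists>t. has_jet n m (\<lambda>h. test_poly k n i0 w e (\<lambda>i. [:a i:] + h i)) t"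
proof -
  have coord: "\<exists>t. has_jet n m (\<lambda>h. [:a i:] + h i) t" if "i < n" for i
    using has_jet_const[of n m "a i"] has_jet_coord[OF that, of m] has_jet_add by blast
  have mult: "\<exists>t. has_jet n m (\<lambda>h. F h * G h) t"
    if "\<exists>t. has_jet n m F t" "\<exists>t. has_jet n m G t" for F G :: "(nat \<Rightarrow> 'a fps poly) \<Rightarrow> _"
    using that has_jet_mult by blast
  have lin: "\<exists>t. has_jet n m (\<lambda>h. lin_poly k u ([:a i0:] + h i0)) t" for u
    unfolding lin_poly_def poly_const_def
    by (intro has_jet_sum mult has_jet_power coord has_jet_const assms) auto
  have fac: "\<exists>t. has_jet n m (\<lambda>h. ([:a j:] + h j) - lin_poly k u ([:a i0:] + h i0)) t" if "j < n" for j u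
    by (rule has_jet_diff[OF coord[OF that] lin])
  have fac_prod: "\<exists>t. has_jet n m (\<lambda>h. \<Prod>u\<in>trunc_fps k - {w j}. ([:a j:] + h j) - lin_poly k u ([:a i0:] + h i0)) t"
    if "j < n" for j
    by (rule has_jet_prod[OF finite_Diff[OF finite_trunc_fps] fac[OF that]])
  have "\<exists>t. has_jet n m (\<lambda>h. \<Prod>j\<in>{..<n} - {i0}. \<Prod>u\<in>trunc_fps k - {w j}.
      ([:a j:] + h j) - lin_poly k u ([:a i0:] + h i0)) t"
    by (rule has_jet_prod[OF finite_Diff[OF finite_lessThan] fac_prod]) auto
  then show ?thesis unfolding test_poly_def
    by (rule mult[OF has_jet_power[OF coord[OF assms]]])
qed

section \<open>Counting heavy directions\<close>

lemma poly_const_X_power: "poly_const a * [:0, 1:] ^ e = Polynomial.monom (fps_const a) e"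
  by (simp add: poly_const_def monom_altdef)

lemma lin_poly_one_X: "k > 0 \<Longrightarrow> lin_poly k 1 [:0, 1:] = [:0, 1:]"
proof -
  assume k: "k > 0"
  have "lin_poly k 1 [:0, 1:] = (\<Sum>j<k. if j = 0 then [:0, 1:] else 0)"
    unfolding lin_poly_def
    by (intro sum.cong refl) (auto simp: poly_const_def pCons_one)
  then show ?thesis using k by simp
qed

lemma order_0_le_of_coeff:
  fixes p :: "'b::idom poly"
  assumes "Polynomial.coeff p i \<noteq> 0"
  shows "p \<noteq> 0 \<and> Polynomial.order 0 p \<le> i"
proof
  show "p \<noteq> 0" using assms by auto
  have "[:0, 1:] ^ Polynomial.order 0 p dvd p" using order_1[of 0 p] by simp
  then obtain r where "p = Polynomial.monom 1 (Polynomial.order 0 p) * r"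
    by (auto simp: monom_altdef elim: dvdE)
  then have "Polynomial.coeff p i
      = (if i < Polynomial.order 0 p then 0 else Polynomial.coeff r (i - Polynomial.order 0 p))"
    by (metis coeff_monom_mult mult_1 not_less)
  then show "Polynomial.order 0 p \<le> i" using assms by (auto split: if_splits)
qed

lemma one_less_card_field: "1 < CARD('a::{field,finite})"
  using card_mono[of "UNIV :: 'a set" "{0, 1}"] by simp

text \<open>The exponents \<open>CARD('a) ^ j\<close> are distinct, so nothing cancels and the
  lowest nonzero coefficient of \<open>f\<close> appears at degree
  \<open>CARD('a) ^ subdegree f\<close>.\<close>

lemma order_lin_poly:
  fixes f :: "'a::{field,finite} fps"
  assumes "f \<in> trunc_fps k" "f \<noteq> 0"
  shows "lin_poly k f [:0, 1:] \<noteq> 0 \<and> Polynomial.order 0 (lin_poly k f [:0, 1:]) \<le> CARD('a) ^ subdegree f"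
proof (rule order_0_le_of_coeff)
  have "Polynomial.coeff (lin_poly k f [:0, 1:]) (CARD('a) ^ subdegree f)
      = (\<Sum>j<k. if j = subdegree f then fps_const (fps_nth f j) else 0)"
    unfolding lin_poly_def poly_const_X_power coeff_sum
    by (intro sum.cong refl) (use one_less_card_field[where ?'a = 'a] in auto)
  also have "\<dots> = fps_const (fps_nth f (subdegree f))"
    using subdegree_less_trunc_fps[OF assms] by simp
  finally show "Polynomial.coeff (lin_poly k f [:0, 1:]) (CARD('a) ^ subdegree f) \<noteq> 0"
    using assms by simp
qed

lemma order_0_prod_le:
  fixes F :: "'i \<Rightarrow> 'b::idom poly"
  assumes "finite A" "\<And>x. x \<in> A \<Longrightarrow> F x \<noteq> 0 \<and> Polynomial.order 0 (F x) \<le> d x"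
  shows "prod F A \<noteq> 0 \<and> Polynomial.order 0 (prod F A) \<le> sum d A"
  using assms
proof (induction A rule: finite_induct)
  case (insert x A)
  then have IH: "prod F A \<noteq> 0" "Polynomial.order 0 (prod F A) \<le> sum d A"
    and x: "F x \<noteq> 0" "Polynomial.order 0 (F x) \<le> d x" by auto
  have "Polynomial.order 0 (F x * prod F A) = Polynomial.order 0 (F x) + Polynomial.order 0 (prod F A)"
    by (rule order_mult) (use IH x in auto)
  then show ?case using insert.hyps IH x by auto
qed auto

text \<open>Coordinate \<open>i0\<close> of the reduced curve is the parameter itself, so each
  factor becomes \<open>lin_poly\<close> of a difference \<open>w j - u\<close>, whose order at 0 is
  controlled. Because \<open>H\<close> does not depend on \<open>e\<close>, the values for varying
  \<open>e\<close> are independent.\<close>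

lemma test_poly_at_direction:
  fixes w :: "nat \<Rightarrow> 'a::{field,finite} fps"
  assumes "k > 0" "w i0 = 1" "w \<in> {..<n} \<rightarrow>\<^sub>E trunc_fps k"
  shows "\<exists>H. H \<noteq> 0 \<and> Polynomial.order 0 H \<le> n * k * CARD('a) ^ k \<and>
    (\<forall>e. test_poly k n i0 w e (\<lambda>i. lin_poly k (w i) [:0, 1:]) = [:0, 1:] ^ e * H)"
proof -
  define H where "H = (\<Prod>j\<in>{..<n} - {i0}. \<Prod>u\<in>trunc_fps k - {w j}. lin_poly k (w j - u) [:0, 1:])"
  have "H \<noteq> 0 \<and> Polynomial.order 0 H \<le> (\<Sum>j\<in>{..<n} - {i0}. k * CARD('a) ^ k)"
    unfolding H_def
  proof (rule order_0_prod_le)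
    fix j assume "j \<in> {..<n} - {i0}"
    then have wj: "w j \<in> trunc_fps k" using assms by auto
    have "(\<Prod>u\<in>trunc_fps k - {w j}. lin_poly k (w j - u) [:0, 1:]) \<noteq> 0 \<and>
        Polynomial.order 0 (\<Prod>u\<in>trunc_fps k - {w j}. lin_poly k (w j - u) [:0, 1:])
        \<le> (\<Sum>u\<in>trunc_fps k - {w j}. CARD('a) ^ subdegree (w j - u))"
      by (rule order_0_prod_le, simp add: finite_trunc_fps, rule order_lin_poly)
         (use wj trunc_fps_diff in auto)
    also have "(\<Sum>u\<in>trunc_fps k - {w j}. CARD('a) ^ subdegree (w j - u))
        = (\<Sum>f\<in>trunc_fps k - {0 :: 'a fps}. CARD('a) ^ subdegree f)"
      by (rule sum.reindex_bij_witness[of _ "\<lambda>f. w j - f" "\<lambda>f. w j - f"])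
         (use wj trunc_fps_diff in auto)
    finally show "(\<Prod>u\<in>trunc_fps k - {w j}. lin_poly k (w j - u) [:0, 1:]) \<noteq> 0 \<and>
        Polynomial.order 0 (\<Prod>u\<in>trunc_fps k - {w j}. lin_poly k (w j - u) [:0, 1:]) \<le> k * CARD('a) ^ k"
      using sum_card_power_subdegree_le[of k, where ?'a = 'a] by linarith
  qed auto
  moreover have "(\<Sum>j\<in>{..<n} - {i0}. k * CARD('a) ^ k) \<le> n * k * CARD('a) ^ k"
    using sum_mono2[of "{..<n}" "{..<n} - {i0}" "\<lambda>_. k * CARD('a) ^ k"] by simp
  moreover have "test_poly k n i0 w e (\<lambda>i. lin_poly k (w i) [:0, 1:]) = [:0, 1:] ^ e * H" for e
    unfolding test_poly_def H_def by (simp add: assms lin_poly_one_X lin_poly_diff)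
  ultimately show ?thesis by (intro exI[of _ H]) (blast intro: order_trans)
qed

text \<open>The two directions agree at \<open>i0\<close> and so differ at another coordinate
  \<open>j\<close>; the factor with \<open>u = w j\<close> vanishes identically.\<close>

lemma test_poly_at_other_direction:
  fixes w w' :: "nat \<Rightarrow> 'a::{field,finite} fps"
  assumes "k > 0" "w i0 = 1" "w' i0 = 1" "w \<in> {..<n} \<rightarrow>\<^sub>E trunc_fps k" "w' \<in> {..<n} \<rightarrow>\<^sub>E trunc_fps k" "w \<noteq> w'"
  shows "test_poly k n i0 w' e (\<lambda>i. lin_poly k (w i) [:0, 1:]) = 0"
proof -
  have "\<not> (\<forall>i\<in>{..<n}. w i = w' i)" using PiE_ext[OF assms(4,5)] assms(6) by blast
  then obtain j where j: "j < n" "w j \<noteq> w' j" by auto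
  have "j \<noteq> i0" using j assms(2,3) by auto
  moreover have "w j \<in> trunc_fps k" using PiE_mem[OF assms(4)] j(1) by simp
  ultimately have "\<exists>j\<in>{..<n} - {i0}. \<exists>u\<in>trunc_fps k - {w' j}.
      lin_poly k (w j) [:0, 1:] - lin_poly k u (lin_poly k (w i0) [:0, 1:]) = 0"
    using j by (intro bexI[of _ j] bexI[of _ "w j"]) (simp_all add: assms(1,2) lin_poly_one_X)
  then show ?thesis
    unfolding test_poly_def by (auto simp: prod_zero_iff finite_trunc_fps)
qed

section \<open>Comparison of vanishing conditions with unknowns\<close>

context carlitz
begin

definition tors_pt :: "'a fps \<Rightarrow> 'a fps" where
  "tors_pt f = Polynomial.coeff (tors f) 0"

lemma tors_eq_const: "tors f = [:tors_pt f:]"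
  unfolding tors_pt_def using act_const[of f fps_X] by (auto simp: tors_def)

lemma tors_pt_nth_0: "fps_nth (tors_pt f) 0 = 0"
  using specialize_tors[of f] by (simp add: tors_eq_const specialize_pCons)

text \<open>Distinct parameters on a curve stay distinct, which lets the orders of vanishing along
  one line add up.\<close>

lemma inj_on_tors_pt: "inj_on tors_pt (trunc_fps k)"
proof (rule inj_onI)
  fix f g assume fg: "f \<in> trunc_fps k" "g \<in> trunc_fps k" "tors_pt f = tors_pt g"
  then have "tors (f - g) = 0" by (simp only: tors_diff) (simp add: tors_eq_const)
  then have "\<forall>i<k. fps_nth (f - g) i = 0" using tors_nonzero by blast
  then have "fps_nth f i = fps_nth g i" for i
    using fg by (cases "i < k") (auto simp: trunc_fps_def)
  then show "f = g" by (simp add: fps_eq_iff)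
qed

lemma specialize_linear_factor: "specialize [:- tors_pt f, 1:] = [:0, 1:]"
  by (rule poly_eqI) (simp add: coeff_specialize coeff_pCons tors_pt_nth_0 split: nat.splits)

text \<open>With fewer conditions than unknowns, some combination \<open>P\<close> of test
  polynomials with a unit coefficient vanishes to order \<open>m v\<close> at every embedded point.
  Reduction along the curve of \<open>w\<close> isolates the unknowns of \<open>w\<close> and forces
  each of them to reduce to 0, a contradiction.\<close>

lemma directions_bound:
  fixes m :: "(nat \<Rightarrow> 'a fps) \<Rightarrow> nat"
  assumes i0: "i0 < n"
    and Om: "Om \<subseteq> {..<n} \<rightarrow>\<^sub>E trunc_fps k" "\<And>w. w \<in> Om \<Longrightarrow> w i0 = 1"
    and lines: "\<And>w. w \<in> Om \<Longrightarrow> M + n * k * CARD('a) ^ k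
        \<le> (\<Sum>r\<in>trunc_fps k. m (\<lambda>i\<in>{..<n}. fps_cutoff k (b w i + r * w i)))"
  shows "card Om * M \<le> (\<Sum>v\<in>{..<n} \<rightarrow>\<^sub>E trunc_fps k. m v ^ n)"
proof (rule ccontr)
  assume neg: "\<not> ?thesis"
  define Sp where "Sp = {..<n} \<rightarrow>\<^sub>E (trunc_fps k :: 'a fps set)"
  have fin_Sp: "finite Sp" by (simp add: Sp_def finite_PiE finite_trunc_fps)
  have fin_Om: "finite Om" using finite_subset[OF Om(1)] fin_Sp by (simp add: Sp_def)
  \<comment> \<open>Unknowns are indexed by a direction and an exponent \<open>e < M\<close>,
    conditions by a point and an exponent vector in its box.\<close>
  define V where "V = Om \<times> {..<M}"
  define I where "I = (SIGMA v:Sp. exponent_box n (m v))"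
  define Q where "Q = (\<lambda>(w :: nat \<Rightarrow> 'a fps, e). test_poly k n i0 w e)"
  have "card I = (\<Sum>v\<in>Sp. m v ^ n)"
    unfolding I_def using fin_Sp by (simp add: card_PiE)
  then have card_less: "card I < card V"
    using neg by (simp add: V_def Sp_def card_cartesian_product)
  have "\<forall>v \<tau>. \<exists>t. has_jet n (m v) (\<lambda>h. Q \<tau> (\<lambda>i. [:tors_pt (v i):] + h i)) t"
    using has_jet_test_poly[OF i0] by (auto simp: Q_def)
  then obtain t where t: "\<And>v \<tau>. has_jet n (m v) (\<lambda>h. Q \<tau> (\<lambda>i. [:tors_pt (v i):] + h i)) (t v \<tau>)"
    by metis
  have "finite I" "finite V" using fin_Sp fin_Om by (auto simp: I_def V_def)
  from fps_homogeneous_system_primitive_solution[OF this card_less, of "\<lambda>(v, \<beta>) \<tau>. t v \<tau> \<beta>"]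
  obtain x where x: "\<exists>\<tau>\<in>V. fps_nth (x \<tau>) 0 \<noteq> 0"
    and sol: "\<And>v \<beta>. v \<in> Sp \<Longrightarrow> \<beta> \<in> exponent_box n (m v) \<Longrightarrow> (\<Sum>\<tau>\<in>V. t v \<tau> \<beta> * x \<tau>) = 0"
    by (auto simp: I_def)
  define P where "P Y = (\<Sum>\<tau>\<in>V. [:x \<tau>:] * Q \<tau> Y)" for Y
  have vanish: "[:0, 1:] ^ m v dvd P (\<lambda>i. tors (v i) + h i)"
    if v: "v \<in> Sp" and h: "\<forall>i<n. [:0, 1:] dvd h i" for v h
  proof -
    let ?B = "exponent_box n (m v)" and ?mon = "\<lambda>\<beta>. \<Prod>i<n. h i ^ \<beta> i"
    have hom: "(\<Sum>\<tau>\<in>V. [:f \<tau>:]) = [:sum f V:]" for f :: "_ \<Rightarrow> 'a fps"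
      by (rule poly_eqI) (simp add: coeff_sum coeff_pCons split: nat.split)
    have "(\<Sum>\<tau>\<in>V. [:x \<tau>:] * (\<Sum>\<beta>\<in>?B. [:t v \<tau> \<beta>:] * ?mon \<beta>))
        = (\<Sum>\<tau>\<in>V. \<Sum>\<beta>\<in>?B. [:t v \<tau> \<beta> * x \<tau>:] * ?mon \<beta>)"
      unfolding sum_distrib_left by (intro sum.cong refl) (simp add: mult.commute)
    also have "\<dots> = (\<Sum>\<beta>\<in>?B. (\<Sum>\<tau>\<in>V. [:t v \<tau> \<beta> * x \<tau>:]) * ?mon \<beta>)"
      unfolding sum_distrib_right by (rule sum.swap)
    also have "\<dots> = 0" unfolding hom by (rule sum.neutral) (simp add: sol[OF v])
    \<comment> \<open>The linear system cancels the jet of \<open>P\<close>, leaving only the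
      combination of the remainders.\<close>
    finally have "P (\<lambda>i. tors (v i) + h i) = (\<Sum>\<tau>\<in>V. [:x \<tau>:] *
        (Q \<tau> (\<lambda>i. tors (v i) + h i) - (\<Sum>\<beta>\<in>?B. [:t v \<tau> \<beta>:] * ?mon \<beta>)))"
      unfolding P_def right_diff_distrib sum_subtractf by simp
    moreover have "[:0, 1:] ^ m v dvd Q \<tau> (\<lambda>i. tors (v i) + h i) - (\<Sum>\<beta>\<in>?B. [:t v \<tau> \<beta>:] * ?mon \<beta>)" for \<tau>
      using t[of v \<tau>] h unfolding has_jet_def tors_eq_const by blast
    ultimately show ?thesis by (auto intro!: dvd_sum dvd_mult simp del: mult_pCons_left)
  qed
  have zero: "fps_nth (x (w, e)) 0 = 0" if w: "w \<in> Om" and e: "e < M" for w e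
  proof (rule ccontr)
    assume xe: "fps_nth (x (w, e)) 0 \<noteq> 0"
    define N where "N = M + n * k * CARD('a) ^ k"
    define v where "v r = (\<lambda>i\<in>{..<n}. fps_cutoff k (b w i + r * w i))" for r
    \<comment> \<open>The lift of the line through \<open>b w\<close> to a curve over the power
      series; at parameter \<open>tors_pt r\<close> it passes through the embedding of
      \<open>v r\<close>.\<close>
    define L where "L = (\<lambda>i. tors (b w i) + act (w i) [:0, 1:])"
    define f where "f = P L"
    have "[:- tors_pt r, 1:] ^ m (v r) dvd f" if "r \<in> trunc_fps k" for r
    proof -
      let ?a = "tors_pt r"
      note endo = ring_endo_pcompose[of "[:?a, 1:]"]
      have "pcompose (L i) [:?a, 1:] = tors (v r i) + act (w i) [:0, 1:]" if "i < n" for i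
      proof -
        have "[:?a, 1:] = tors r + [:0, 1:]" by (simp add: tors_eq_const)
        moreover have "pcompose (act (w i) [:0, 1:]) [:?a, 1:] = act (w i) [:?a, 1:]"
          by (subst ring_endo_act[OF endo]) (auto simp: poly_const_def pcompose_pCons)
        ultimately have "pcompose (L i) [:?a, 1:] = tors (b w i) + (tors (w i * r) + act (w i) [:0, 1:])"
          by (simp add: L_def pcompose_add act_add act_tors) (simp add: tors_eq_const)
        also have "\<dots> = tors (b w i + r * w i) + act (w i) [:0, 1:]"
          by (simp add: tors_add mult.commute add.assoc)
        also have "tors (b w i + r * w i) = tors (v r i)"
          by (rule tors_cong) (use that in \<open>simp add: v_def\<close>)
        finally show ?thesis .
      qed
      then have "pcompose f [:?a, 1:] = P (\<lambda>i. tors (v r i) + act (w i) [:0, 1:])"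
        unfolding f_def P_def pcompose_sum pcompose_mult pcompose_const
        by (intro sum.cong refl arg_cong2[where f = "(*)"])
           (auto simp: Q_def ring_endo_test_poly[OF endo] poly_const_def intro!: test_poly_cong[OF i0])
      moreover have "v r \<in> Sp" by (auto simp: v_def Sp_def)
      ultimately have "[:0, 1:] ^ m (v r) dvd pcompose f [:?a, 1:]"
        using vanish[of "v r"] X_dvd_act_X by simp
      then obtain g where "pcompose f [:?a, 1:] = [:0, 1:] ^ m (v r) * g" by (elim dvdE)
      then have "pcompose (pcompose f [:?a, 1:]) [:- ?a, 1:] = [:- ?a, 1:] ^ m (v r) * pcompose g [:- ?a, 1:]"
        by (simp add: ring_endo_simps[OF ring_endo_pcompose] pcompose_pCons)
      moreover have "pcompose (pcompose f [:?a, 1:]) [:- ?a, 1:] = f"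
        by (simp add: pcompose_assoc[symmetric] pcompose_pCons)
      ultimately show ?thesis by simp
    qed
    then have "(\<Prod>r\<in>trunc_fps k. [:- tors_pt r, 1:] ^ m (v r)) dvd f"
      by (intro prod_linear_powers_dvd finite_trunc_fps inj_on_tors_pt)
    then obtain g where "f = (\<Prod>r\<in>trunc_fps k. [:- tors_pt r, 1:] ^ m (v r)) * g" by (elim dvdE)
    \<comment> \<open>Every root \<open>tors_pt r\<close> reduces to 0, so vanishing at the separate
      points of the line accumulates at the origin.\<close>
    then have "specialize f = [:0, 1:] ^ (\<Sum>r\<in>trunc_fps k. m (v r)) * specialize g"
      by (simp add: ring_endo_simps[OF ring_endo_specialize] specialize_linear_factor power_sum)
    moreover have "N \<le> (\<Sum>r\<in>trunc_fps k. m (v r))"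
      using lines[OF w] by (simp add: N_def v_def)
    ultimately have dvd: "[:0, 1:] ^ N dvd specialize f"
      by (auto intro: dvd_mult2 le_imp_power_dvd)
    have specialize_L: "specialize (L i) = lin_poly k (w i) [:0, 1:]" for i
      by (simp add: L_def ring_endo_simps[OF ring_endo_specialize] specialize_tors specialize_act)
    obtain H where H: "H \<noteq> 0" "Polynomial.order 0 H \<le> n * k * CARD('a) ^ k"
      "\<And>e. test_poly k n i0 w e (\<lambda>i. lin_poly k (w i) [:0, 1:]) = [:0, 1:] ^ e * H"
      using test_poly_at_direction[of k w i0 n] k_pos Om(2)[OF w] w Om(1) by blast
    define y where "y e = fps_nth (x (w, e)) 0" for e
    define p where "p = (\<Sum>e<M. Polynomial.monom (fps_const (y e)) e)"
    have "specialize f = (\<Sum>\<tau>\<in>V. specialize [:x \<tau>:] * Q \<tau> (\<lambda>i. lin_poly k (w i) [:0, 1:]))"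
      unfolding f_def P_def
      by (auto simp: ring_endo_simps[OF ring_endo_specialize] Q_def specialize_L
          ring_endo_test_poly[OF ring_endo_specialize] simp del: mult_pCons_left intro!: sum.cong)
    also have "\<dots> = (\<Sum>\<tau>\<in>{w} \<times> {..<M}. specialize [:x \<tau>:] * Q \<tau> (\<lambda>i. lin_poly k (w i) [:0, 1:]))"
    proof (rule sum.mono_neutral_right)
      show "\<forall>\<tau>\<in>V - {w} \<times> {..<M}. specialize [:x \<tau>:] * Q \<tau> (\<lambda>i. lin_poly k (w i) [:0, 1:]) = 0"
      proof
        fix \<tau> assume "\<tau> \<in> V - {w} \<times> {..<M}"
        then obtain w' e' where \<tau>: "\<tau> = (w', e')" "w' \<in> Om" "w' \<noteq> w" by (auto simp: V_def)
        have "test_poly k n i0 w' e' (\<lambda>i. lin_poly k (w i) [:0, 1:]) = 0"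
          by (rule test_poly_at_other_direction[OF k_pos]) (use \<tau> w Om in auto)
        then show "specialize [:x \<tau>:] * Q \<tau> (\<lambda>i. lin_poly k (w i) [:0, 1:]) = 0"
          by (simp add: \<tau> Q_def)
      qed
    qed (use w \<open>finite V\<close> in \<open>auto simp: V_def\<close>)
    also have "\<dots> = (\<Sum>e<M. poly_const (y e) * ([:0, 1:] ^ e * H))"
      by (rule sum.reindex_bij_witness[of _ "\<lambda>e. (w, e)" snd])
         (auto simp: Q_def H(3) specialize_pCons poly_const_def y_def)
    also have "\<dots> = p * H"
      by (simp add: p_def sum_distrib_right flip: poly_const_X_power mult.assoc)
    finally have pH: "specialize f = p * H" .
    have "Polynomial.coeff p e = fps_const (y e)"
      using e by (simp add: p_def coeff_sum)
    then have p: "p \<noteq> 0" "Polynomial.order 0 p \<le> e"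
      using order_0_le_of_coeff[of p e] xe by (auto simp: y_def)
    \<comment> \<open>Coefficient \<open>e\<close> of \<open>p\<close> is nonzero, so
      \<open>p * H\<close> has order at most \<open>e + n * k * CARD('a) ^ k\<close>, which is below
      \<open>N\<close> because \<open>e < M\<close>.\<close>
    have "N \<le> Polynomial.order 0 (p * H)"
      using dvd p(1) H(1) order_divides[of 0 N "p * H"] unfolding pH by simp
    also have "\<dots> = Polynomial.order 0 p + Polynomial.order 0 H"
      by (rule order_mult) (use p H in auto)
    finally show False using p(2) H(2) e by (simp add: N_def)
  qed
  then show False using x by (auto simp: V_def)
qed

end

section \<open>The maximal inequality for truncated power series\<close>

lemma directions_bound_truncated:
  fixes m :: "(nat \<Rightarrow> 'a::{field,finite} fps) \<Rightarrow> nat"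
  assumes "primepow CARD('a)" "k > 0" "i0 < n"
    and "Om \<subseteq> {..<n} \<rightarrow>\<^sub>E trunc_fps k" "\<And>w. w \<in> Om \<Longrightarrow> w i0 = 1"
    and "\<And>w. w \<in> Om \<Longrightarrow> M + n * k * CARD('a) ^ k
        \<le> (\<Sum>r\<in>trunc_fps k. m (\<lambda>i\<in>{..<n}. fps_cutoff k (b w i + r * w i)))"
  shows "card Om * M \<le> (\<Sum>v\<in>{..<n} \<rightarrow>\<^sub>E trunc_fps k. m v ^ n)"
proof -
  obtain c :: "'a fps" where "fps_nth c 0 = 0" "(twist CARD('a) c ^^ k) fps_X = 0"
      "(twist CARD('a) c ^^ (k - 1)) fps_X \<noteq> 0"
    using twist_torsion_exists[of "CARD('a)" k] one_less_card_field[where ?'a = 'a] assms(2) by auto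
  then interpret carlitz k c using assms by unfold_locales auto
  show ?thesis using directions_bound[of i0 n Om M m b] assms by blast
qed

text \<open>Real weights are scaled and rounded down to integer multiplicities, to which the
  counting bound applies with \<open>M = n * k * CARD('a) ^ k\<close>.\<close>

lemma normalized_directions_bound:
  fixes \<psi> :: "(nat \<Rightarrow> 'a::{field,finite} fps) \<Rightarrow> real"
  assumes pp: "primepow CARD('a)" and k: "k > 0" and i0: "i0 < n" and lam: "lam > 0"
    and pos: "\<And>v. \<psi> v \<ge> 0"
    and Om: "Om \<subseteq> {..<n} \<rightarrow>\<^sub>E trunc_fps k" "\<And>w. w \<in> Om \<Longrightarrow> w i0 = 1"
    and lines: "\<And>w. w \<in> Om \<Longrightarrow> lam * real CARD('a) ^ k
        \<le> (\<Sum>r\<in>trunc_fps k. \<psi> (\<lambda>i\<in>{..<n}. fps_cutoff k (b w i + r * w i)))"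
  shows "real (card Om) * (real n * real k * real CARD('a) ^ k) * lam ^ n
      \<le> (3 * real n * real k) ^ n * (\<Sum>v\<in>{..<n} \<rightarrow>\<^sub>E trunc_fps k. \<psi> v ^ n)"
proof -
  define q where "q = real CARD('a)"
  \<comment> \<open>Rounding loses at most 1 at each of at most \<open>q ^ k\<close> parameters. The
    summand 1 pays for this, and the rest leaves \<open>2 * n * k * q ^ k\<close>, which is
    \<open>M\<close> plus the extra order demanded by
    \<open>directions_bound_truncated\<close>.\<close>
  define \<rho> where "\<rho> = (2 * real n * real k + 1) / lam"
  have \<rho>: "\<rho> > 0" "\<rho> * lam = 2 * real n * real k + 1" using lam by (auto simp: \<rho>_def add_nonneg_pos)
  define m where "m v = nat \<lfloor>\<rho> * \<psi> v\<rfloor>" for v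
  have m_le: "real (m v) \<le> \<rho> * \<psi> v" and m_ge: "\<rho> * \<psi> v - 1 \<le> real (m v)" for v
  proof -
    have "0 \<le> \<rho> * \<psi> v" using \<rho> pos by simp
    then have "real (m v) = of_int \<lfloor>\<rho> * \<psi> v\<rfloor>" by (simp add: m_def)
    then show "real (m v) \<le> \<rho> * \<psi> v" "\<rho> * \<psi> v - 1 \<le> real (m v)" by linarith+
  qed
  define M where "M = n * k * CARD('a) ^ k"
  have M: "M + n * k * CARD('a) ^ k \<le> (\<Sum>r\<in>trunc_fps k. m (\<lambda>i\<in>{..<n}. fps_cutoff k (b w i + r * w i)))"
    if w: "w \<in> Om" for w
  proof -
    let ?v = "\<lambda>r. \<lambda>i\<in>{..<n}. fps_cutoff k (b w i + r * w i)"
    have card: "real (card (trunc_fps k :: 'a fps set)) \<le> q ^ k"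
      using card_trunc_fps_le[of k, where ?'a = 'a] unfolding q_def by (metis of_nat_le_iff of_nat_power)
    have "real (M + n * k * CARD('a) ^ k) = \<rho> * (lam * q ^ k) - q ^ k"
      unfolding mult.assoc[symmetric] \<rho>(2) by (simp add: M_def q_def algebra_simps)
    also have "\<dots> \<le> \<rho> * (\<Sum>r\<in>trunc_fps k. \<psi> (?v r)) - real (card (trunc_fps k :: 'a fps set))"
      using lines[OF w] \<rho>(1) card by (intro diff_mono mult_left_mono) (auto simp: q_def)
    also have "\<dots> = (\<Sum>r\<in>trunc_fps k. \<rho> * \<psi> (?v r) - 1)"
      by (simp add: sum_subtractf sum_distrib_left)
    also have "\<dots> \<le> (\<Sum>r\<in>trunc_fps k. real (m (?v r)))"
      by (intro sum_mono m_ge)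
    finally show ?thesis by (simp only: of_nat_sum[symmetric] of_nat_le_iff)
  qed
  have "card Om * M \<le> (\<Sum>v\<in>{..<n} \<rightarrow>\<^sub>E trunc_fps k. m v ^ n)"
    by (rule directions_bound_truncated[where b = b, OF pp k i0 Om(1)]) (use Om(2) M in auto)
  then have "real (card Om * M) \<le> real (\<Sum>v\<in>{..<n} \<rightarrow>\<^sub>E trunc_fps k. m v ^ n)"
    by (simp only: of_nat_le_iff)
  then have "real (card Om) * real M \<le> (\<Sum>v\<in>{..<n} \<rightarrow>\<^sub>E trunc_fps k. real (m v) ^ n)"
    by simp
  also have "\<dots> \<le> (\<Sum>v\<in>{..<n} \<rightarrow>\<^sub>E trunc_fps k. (\<rho> * \<psi> v) ^ n)"
    by (intro sum_mono power_mono m_le) auto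
  also have "\<dots> = \<rho> ^ n * (\<Sum>v\<in>{..<n} \<rightarrow>\<^sub>E trunc_fps k. \<psi> v ^ n)"
    by (simp add: power_mult_distrib sum_distrib_left)
  finally have "real (card Om) * real M * lam ^ n \<le> \<rho> ^ n * (\<Sum>v\<in>{..<n} \<rightarrow>\<^sub>E trunc_fps k. \<psi> v ^ n) * lam ^ n"
    using lam by (intro mult_right_mono) auto
  also have "\<dots> = (2 * real n * real k + 1) ^ n * (\<Sum>v\<in>{..<n} \<rightarrow>\<^sub>E trunc_fps k. \<psi> v ^ n)"
    by (simp flip: \<rho>(2) add: power_mult_distrib)
  also have "\<dots> \<le> (3 * real n * real k) ^ n * (\<Sum>v\<in>{..<n} \<rightarrow>\<^sub>E trunc_fps k. \<psi> v ^ n)"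
  proof (intro mult_right_mono power_mono sum_nonneg zero_le_power pos)
    have "1 \<le> n * k" using i0 k by (simp add: Suc_le_eq)
    then have "1 \<le> real (n * k)" by (metis of_nat_1 of_nat_le_iff)
    then show "2 * real n * real k + 1 \<le> 3 * real n * real k" by (simp add: mult.commute)
  qed simp
  finally show ?thesis by (simp add: M_def)
qed

section \<open>Scaling directions to make one coordinate equal to 1\<close>

lemma fps_cutoff_mult_cutoff_left: "fps_cutoff k (fps_cutoff k f * g) = fps_cutoff k (f * g)"
  by (auto simp: fps_cutoff_eq_fps_cutoff_iff fps_cutoff_left_mult_nth)

lemma fps_cutoff_mult_cutoff_right: "fps_cutoff k (f * fps_cutoff k g) = fps_cutoff k (f * g)"
  by (auto simp: fps_cutoff_eq_fps_cutoff_iff fps_cutoff_right_mult_nth)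

lemma fps_cutoff_trunc_fps: "f \<in> trunc_fps k \<Longrightarrow> fps_cutoff k f = f"
  by (auto simp: trunc_fps_def fps_eq_iff)

text \<open>Dividing a direction by its unit \<open>w i0\<close> only reparametrizes the line, so
  its weight is unchanged. At most \<open>CARD('a) ^ k\<close> directions share a normalization, and
  the factor \<open>CARD('a) ^ k\<close> on the left of the normalized bound absorbs this
  loss.\<close>

lemma unit_coordinate_directions_bound:
  fixes \<psi> :: "(nat \<Rightarrow> 'a::{field,finite} fps) \<Rightarrow> real"
  assumes pp: "primepow CARD('a)" and k: "k > 0" and i0: "i0 < n" and lam: "lam > 0"
    and pos: "\<And>v. \<psi> v \<ge> 0"
    and Om: "Om \<subseteq> {..<n} \<rightarrow>\<^sub>E trunc_fps k" "\<And>w. w \<in> Om \<Longrightarrow> fps_nth (w i0) 0 \<noteq> 0"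
    and lines: "\<And>w. w \<in> Om \<Longrightarrow> \<exists>b. lam * real CARD('a) ^ k
        \<le> (\<Sum>r\<in>trunc_fps k. \<psi> (\<lambda>i\<in>{..<n}. fps_cutoff k (b i + r * w i)))"
  shows "real (card Om) * real n * lam ^ n
      \<le> (3 * real n * real k) ^ n * (\<Sum>v\<in>{..<n} \<rightarrow>\<^sub>E trunc_fps k. \<psi> v ^ n)"
proof -
  define nrm :: "(nat \<Rightarrow> 'a fps) \<Rightarrow> nat \<Rightarrow> 'a fps"
    where "nrm w = (\<lambda>i\<in>{..<n}. fps_cutoff k (w i * inverse (w i0)))" for w
  have inv: "w i0 * inverse (w i0) = 1" "inverse (w i0) * w i0 = 1" if "w \<in> Om" for w
    using Om(2)[OF that] by (simp_all add: inverse_mult_eq_1 inverse_mult_eq_1')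
  have fin: "finite Om"
    using finite_subset[OF Om(1)] by (simp add: finite_PiE finite_trunc_fps)
  have nrm_mult: "fps_cutoff k (nrm w i * w i0) = w i" if "w \<in> Om" "i < n" for w i
  proof -
    have "fps_cutoff k (nrm w i * w i0) = fps_cutoff k (w i * (inverse (w i0) * w i0))"
      using that by (simp add: nrm_def fps_cutoff_mult_cutoff_left mult.assoc)
    also have "\<dots> = w i" using that Om(1) by (auto simp: inv intro!: fps_cutoff_trunc_fps)
    finally show ?thesis .
  qed
  have inj: "inj_on (\<lambda>w. (nrm w, w i0)) Om"
  proof (rule inj_onI)
    fix w w' assume w: "w \<in> Om" "w' \<in> Om" and eq: "(nrm w, w i0) = (nrm w', w' i0)"
    have "w i = w' i" if "i < n" for i
      using nrm_mult[OF w(1) that] nrm_mult[OF w(2) that] eq by simp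
    then show "w = w'" using w Om(1) by (intro PiE_ext[of w "{..<n}" _ w']) auto
  qed
  have "card Om \<le> card (nrm ` Om \<times> (trunc_fps k :: 'a fps set))"
    by (rule card_inj_on_le[OF inj]) (use Om(1) i0 fin in \<open>auto simp: finite_trunc_fps\<close>)
  also have "\<dots> \<le> card (nrm ` Om) * CARD('a) ^ k"
    by (simp add: card_cartesian_product card_trunc_fps_le)
  finally have card_le: "real (card Om) \<le> real (card (nrm ` Om)) * real CARD('a) ^ k"
    by (metis of_nat_le_iff of_nat_mult of_nat_power)
  have "\<exists>b. lam * real CARD('a) ^ k
        \<le> (\<Sum>r\<in>trunc_fps k. \<psi> (\<lambda>i\<in>{..<n}. fps_cutoff k (b i + r * nrm w i)))" if w: "w \<in> Om" for w
  proof -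
    obtain b where b: "lam * real CARD('a) ^ k
        \<le> (\<Sum>r\<in>trunc_fps k. \<psi> (\<lambda>i\<in>{..<n}. fps_cutoff k (b i + r * w i)))" using lines[OF w] by blast
    also have "\<dots> = (\<Sum>r\<in>trunc_fps k. \<psi> (\<lambda>i\<in>{..<n}. fps_cutoff k (b i + r * nrm w i)))"
    proof (rule sum.reindex_bij_witness[of _ "\<lambda>r. fps_cutoff k (r * inverse (w i0))" "\<lambda>r. fps_cutoff k (r * w i0)"])
      fix r :: "'a fps" assume r: "r \<in> trunc_fps k"
      show "fps_cutoff k (fps_cutoff k (r * w i0) * inverse (w i0)) = r"
        "fps_cutoff k (fps_cutoff k (r * inverse (w i0)) * w i0) = r"
        using r by (simp_all add: fps_cutoff_mult_cutoff_left mult.assoc inv[OF w] fps_cutoff_trunc_fps)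
      have "fps_cutoff k (fps_cutoff k (r * w i0) * nrm w i) = fps_cutoff k (r * w i)" if "i < n" for i
      proof -
        have "fps_cutoff k (fps_cutoff k (r * w i0) * nrm w i) = fps_cutoff k (r * (nrm w i * w i0))"
          unfolding fps_cutoff_mult_cutoff_left by (simp add: mult_ac)
        also have "\<dots> = fps_cutoff k (r * w i)"
          by (metis fps_cutoff_mult_cutoff_right nrm_mult[OF w that])
        finally show ?thesis .
      qed
      then have "(\<lambda>i\<in>{..<n}. fps_cutoff k (b i + fps_cutoff k (r * w i0) * nrm w i))
          = (\<lambda>i\<in>{..<n}. fps_cutoff k (b i + r * w i))"
        by (auto simp: fps_cutoff_add)
      then show "\<psi> (\<lambda>i\<in>{..<n}. fps_cutoff k (b i + fps_cutoff k (r * w i0) * nrm w i))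
          = \<psi> (\<lambda>i\<in>{..<n}. fps_cutoff k (b i + r * w i))" by simp
    qed auto
    finally show ?thesis by blast
  qed
  then have "\<forall>w\<in>nrm ` Om. \<exists>b. lam * real CARD('a) ^ k
        \<le> (\<Sum>r\<in>trunc_fps k. \<psi> (\<lambda>i\<in>{..<n}. fps_cutoff k (b i + r * w i)))" by blast
  from bchoice[OF this] obtain b where b: "\<And>w. w \<in> nrm ` Om \<Longrightarrow> lam * real CARD('a) ^ k
        \<le> (\<Sum>r\<in>trunc_fps k. \<psi> (\<lambda>i\<in>{..<n}. fps_cutoff k (b w i + r * w i)))" by auto
  have nrm_1: "w i0 = 1" if "w \<in> nrm ` Om" for w
    using that i0 k by (auto simp: nrm_def inv fps_cutoff_one)
  have "nrm ` Om \<subseteq> {..<n} \<rightarrow>\<^sub>E trunc_fps k" by (auto simp: nrm_def split: if_splits)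
  then have "real (card (nrm ` Om)) * (real n * real k * real CARD('a) ^ k) * lam ^ n
      \<le> (3 * real n * real k) ^ n * (\<Sum>v\<in>{..<n} \<rightarrow>\<^sub>E trunc_fps k. \<psi> v ^ n)"
    by (rule normalized_directions_bound[where b = b, OF pp k i0 lam pos]) (use nrm_1 b in auto)
  moreover have "real (card Om) * real n * lam ^ n
      \<le> real (card (nrm ` Om)) * (real n * real k * real CARD('a) ^ k) * lam ^ n"
  proof (rule mult_right_mono)
    have "real (card Om) * real n \<le> (real (card (nrm ` Om)) * real CARD('a) ^ k) * real n * 1"
      using card_le by (simp add: mult_right_mono)
    also have "\<dots> \<le> (real (card (nrm ` Om)) * real CARD('a) ^ k) * real n * real k"
      using k by (intro mult_left_mono) auto
    finally show "real (card Om) * real n \<le> real (card (nrm ` Om)) * (real n * real k * real CARD('a) ^ k)"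
      by (simp add: mult_ac)
  qed (use lam in simp)
  ultimately show ?thesis by linarith
qed

text \<open>Summing over the \<open>n\<close> possible positions of a unit coordinate costs a factor
  \<open>n\<close>, which the factor \<open>real n\<close> in the bound for each position
  cancels.\<close>

lemma truncated_maximal_bound:
  fixes \<psi> :: "(nat \<Rightarrow> 'a::{field,finite} fps) \<Rightarrow> real"
  assumes pp: "primepow CARD('a)" and k: "k > 0" and n: "n \<ge> 1" and lam: "lam > 0"
    and pos: "\<And>v. \<psi> v \<ge> 0"
    and Om: "Om \<subseteq> {..<n} \<rightarrow>\<^sub>E trunc_fps k" "\<And>w. w \<in> Om \<Longrightarrow> \<exists>i<n. fps_nth (w i) 0 \<noteq> 0"
    and lines: "\<And>w. w \<in> Om \<Longrightarrow> \<exists>b. lam * real CARD('a) ^ k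
        \<le> (\<Sum>r\<in>trunc_fps k. \<psi> (\<lambda>i\<in>{..<n}. fps_cutoff k (b i + r * w i)))"
  shows "real (card Om) * lam ^ n
      \<le> (3 * real n * real k) ^ n * (\<Sum>v\<in>{..<n} \<rightarrow>\<^sub>E trunc_fps k. \<psi> v ^ n)"
proof -
  define A where "A = (3 * real n * real k) ^ n * (\<Sum>v\<in>{..<n} \<rightarrow>\<^sub>E trunc_fps k. \<psi> v ^ n)"
  define U where "U i = {w \<in> Om. fps_nth (w i) 0 \<noteq> 0}" for i
  have bound: "real (card (U i)) * real n * lam ^ n \<le> A" if "i < n" for i
    unfolding A_def
    by (rule unit_coordinate_directions_bound[OF pp k that lam pos])
       (use Om(1) lines in \<open>auto simp: U_def\<close>)
  have "Om = (\<Union>i<n. U i)" using Om(2) by (auto simp: U_def)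
  then have "card Om \<le> (\<Sum>i<n. card (U i))" by (metis card_UN_le finite_lessThan)
  then have "real (card Om) \<le> (\<Sum>i<n. real (card (U i)))" by (metis of_nat_le_iff of_nat_sum)
  then have "real (card Om) * (real n * lam ^ n) \<le> (\<Sum>i<n. real (card (U i))) * (real n * lam ^ n)"
    using lam by (intro mult_right_mono) auto
  also have "\<dots> = (\<Sum>i<n. real (card (U i)) * real n * lam ^ n)"
    by (simp add: sum_distrib_right mult.assoc)
  also have "\<dots> \<le> (\<Sum>i<n. A)" by (intro sum_mono bound) auto
  finally have "real n * (real (card Om) * lam ^ n) \<le> real n * A" by (simp add: mult_ac)
  then show ?thesis using n by (simp add: A_def)
qed

section \<open>Passage to the quotient ring\<close>

definition trunc_coset :: "nat \<Rightarrow> 'a::field fps \<Rightarrow> 'a fps set" where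
  "trunc_coset k f = {g. fps_cutoff k g = fps_cutoff k f}"

lemma ring_of_type_algebra_simps [simp]:
  "carrier ring_of_type_algebra = UNIV"
  "x \<otimes>\<^bsub>ring_of_type_algebra\<^esub> y = x * y"
  "x \<oplus>\<^bsub>ring_of_type_algebra\<^esub> y = x + y"
  by (simp_all add: ring_of_type_algebra_def)

lemma trunc_coset_eq_iff: "trunc_coset k f = trunc_coset k g \<longleftrightarrow> fps_cutoff k f = fps_cutoff k g"
  by (auto simp: trunc_coset_def)

lemma trunc_coset_cutoff [simp]: "trunc_coset k (fps_cutoff k f) = trunc_coset k f"
  by (simp add: trunc_coset_eq_iff fps_cutoff_trunc_fps)

text \<open>Divisibility by \<open>fps_X ^ k\<close> means that the first \<open>k\<close>
  coefficients vanish, so the abstract cosets are the classes of equal cutoff.\<close>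

lemma trunc_ideal_coset: "trunc_ideal k +>\<^bsub>ring_of_type_algebra\<^esub> f = trunc_coset k f"
proof -
  have ideal: "trunc_ideal k = {g :: 'a fps. fps_X ^ k dvd g}"
    by (auto simp: trunc_ideal_def cgenideal_def dvd_def mult.commute)
  show ?thesis
    unfolding a_r_coset_def' ideal fps_X_power_dvd_iff_nth trunc_coset_def fps_cutoff_eq_fps_cutoff_iff
  proof safe
    fix g assume "\<forall>i<k. fps_nth g i = fps_nth f i"
    then show "g \<in> (\<Union>h\<in>{g. \<forall>i<k. fps_nth g i = 0}. {h \<oplus>\<^bsub>ring_of_type_algebra\<^esub> f})"
      by (intro UN_I[of "g - f"]) auto
  qed auto
qed

lemma ideal_trunc_ideal: "ideal (trunc_ideal k :: 'a::{field,finite} fps set) ring_of_type_algebra"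
  unfolding trunc_ideal_def by (rule cring.cgenideal_ideal[OF cring_from_type_algebra]) simp

lemma carrier_trunc_ring: "carrier (trunc_ring k) = range (trunc_coset k)"
  by (auto simp: trunc_ring_def FactRing_def A_RCOSETS_def' trunc_ideal_coset)

lemma trunc_ring_add: "trunc_coset k f \<oplus>\<^bsub>trunc_ring k\<^esub> trunc_coset k g = trunc_coset k (f + g)"
  using ideal.a_rcos_sum[OF ideal_trunc_ideal[of k], of f g]
  by (simp add: trunc_ring_def FactRing_def trunc_ideal_coset)

lemma trunc_ring_mult: "trunc_coset k f \<otimes>\<^bsub>trunc_ring k\<^esub> trunc_coset k g = trunc_coset k (f * g)"
  using ideal.rcoset_mult_add[OF ideal_trunc_ideal[of k], of f g]
  by (simp add: trunc_ring_def FactRing_def trunc_ideal_coset)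

text \<open>A series without constant term is a multiple of \<open>fps_X\<close>. Contrapositively,
  a primitive vector has a coordinate with nonzero constant term.\<close>

lemma trunc_coset_in_maximal_ideal:
  assumes "fps_nth f 0 = 0"
  shows "trunc_coset k f \<in> PIdl\<^bsub>trunc_ring k\<^esub> (trunc_t k)"
proof -
  have "f = fps_shift 1 f * fps_X"
    using assms by (auto simp: fps_eq_iff)
  then have "trunc_coset k f = trunc_coset k (fps_shift 1 f) \<otimes>\<^bsub>trunc_ring k\<^esub> trunc_t k"
    by (metis trunc_ring_mult trunc_t_def trunc_ideal_coset)
  then show ?thesis by (auto simp: cgenideal_def carrier_trunc_ring)
qed

text \<open>Restricted to \<open>{..<n}\<close> to match the extensional vectors of
  \<open>trunc_space\<close>, onto which it maps the truncated vectors bijectively.\<close>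

definition coset_vec :: "nat \<Rightarrow> nat \<Rightarrow> (nat \<Rightarrow> 'a::field fps) \<Rightarrow> nat \<Rightarrow> 'a fps set" where
  "coset_vec n k v = (\<lambda>i\<in>{..<n}. trunc_coset k (v i))"

lemma inj_on_coset_vec: "inj_on (coset_vec n k) ({..<n} \<rightarrow>\<^sub>E trunc_fps k)"
proof (rule inj_onI)
  fix v w :: "nat \<Rightarrow> 'a fps"
  assume vw: "v \<in> {..<n} \<rightarrow>\<^sub>E trunc_fps k" "w \<in> {..<n} \<rightarrow>\<^sub>E trunc_fps k" "coset_vec n k v = coset_vec n k w"
  have "v i = w i" if "i < n" for i
  proof -
    have "fps_cutoff k (v i) = fps_cutoff k (w i)"
      using fun_cong[OF vw(3), of i] that by (simp add: coset_vec_def trunc_coset_eq_iff)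
    moreover have "v i \<in> trunc_fps k" "w i \<in> trunc_fps k" using vw that by auto
    ultimately show ?thesis by (simp add: fps_cutoff_trunc_fps)
  qed
  then show "v = w" using vw by (intro PiE_ext[of v "{..<n}" _ w]) auto
qed

lemma coset_vec_image:
  "coset_vec n k ` ({..<n} \<rightarrow>\<^sub>E trunc_fps k)
    = (trunc_space n k :: (nat \<Rightarrow> 'a::{field,finite} fps set) set)" (is "?L = ?R")
proof
  show "?L \<subseteq> ?R"
    by (simp add: image_subset_iff trunc_space_def coset_vec_def carrier_trunc_ring restrict_PiE_iff)
  show "?R \<subseteq> ?L"
  proof
    fix w :: "nat \<Rightarrow> 'a fps set" assume w: "w \<in> ?R"
    then have "\<forall>i\<in>{..<n}. \<exists>f. w i = trunc_coset k f"
      unfolding trunc_space_def carrier_trunc_ring PiE_iff by blast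
    from bchoice[OF this] obtain F where F: "\<And>i. i < n \<Longrightarrow> w i = trunc_coset k (F i)" by auto
    have "w = coset_vec n k (\<lambda>i\<in>{..<n}. fps_cutoff k (F i))"
      using w F by (intro PiE_ext[of w "{..<n}" "\<lambda>_. UNIV"]) (auto simp: trunc_space_def coset_vec_def)
    moreover have "(\<lambda>i\<in>{..<n}. fps_cutoff k (F i)) \<in> {..<n} \<rightarrow>\<^sub>E trunc_fps k"
      by (simp add: restrict_PiE_iff)
    ultimately show "w \<in> ?L"
      by (rule image_eqI)
  qed
qed

lemma finite_trunc_space: "finite (trunc_space n k)"
  by (simp add: finite_PiE finite_trunc_fps flip: coset_vec_image)

lemma trunc_line_eq:
  fixes b w :: "nat \<Rightarrow> 'a::{field,finite} fps"
  shows "trunc_line n k (coset_vec n k b) (coset_vec n k w)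
    = (\<lambda>r. coset_vec n k (\<lambda>i\<in>{..<n}. fps_cutoff k (b i + r * w i))) ` trunc_fps k"
proof -
  have carrier: "carrier (trunc_ring k) = trunc_coset k ` (trunc_fps k :: 'a fps set)"
    unfolding carrier_trunc_ring
  proof safe
    fix f :: "'a fps" show "trunc_coset k f \<in> trunc_coset k ` trunc_fps k"
      by (rule image_eqI[of _ _ "fps_cutoff k f"]) simp_all
  qed simp
  show ?thesis
    unfolding trunc_line_def carrier image_image
    by (intro image_cong refl ext) (simp add: coset_vec_def trunc_ring_add trunc_ring_mult)
qed

lemma primitive_vector_unit_coordinate:
  assumes "coset_vec n k w \<in> primitive_vectors n k"
  shows "\<exists>i<n. fps_nth (w i) 0 \<noteq> 0"
proof (rule ccontr)
  assume "\<not> ?thesis"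
  then have "coset_vec n k w \<in> {..<n} \<rightarrow>\<^sub>E PIdl\<^bsub>trunc_ring k\<^esub> (trunc_t k)"
    by (auto simp: coset_vec_def intro!: trunc_coset_in_maximal_ideal)
  then show False using assms by (simp add: primitive_vectors_def)
qed

text \<open>The lines in a given direction form a finite nonempty family, so the supremum is
  attained and an actual line is available for the counting.\<close>

lemma kakeya_maximal_attained:
  fixes \<phi> :: "(nat \<Rightarrow> 'a::{field,finite} fps set) \<Rightarrow> real"
  assumes "kakeya_maximal n k \<phi> (coset_vec n k w) \<ge> lam"
  shows "\<exists>b. lam * real CARD('a) ^ k \<le>
    (\<Sum>r\<in>trunc_fps k. \<bar>\<phi> (coset_vec n k (\<lambda>i\<in>{..<n}. fps_cutoff k (b i + r * w i)))\<bar>)"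
proof -
  let ?S = "(\<lambda>l. (\<Sum>v\<in>l. \<bar>\<phi> v\<bar>) / real CARD('a) ^ k) ` lines_in_direction n k (coset_vec n k w)"
  have "(\<lambda>i\<in>{..<n}. 0) \<in> {..<n} \<rightarrow>\<^sub>E (trunc_fps k :: 'a fps set)" by (auto simp: trunc_fps_def)
  then have "trunc_space n k \<noteq> ({} :: (nat \<Rightarrow> 'a fps set) set)" unfolding coset_vec_image[symmetric] by blast
  then have "?S \<noteq> {}" "finite ?S" by (auto simp: lines_in_direction_def finite_trunc_space)
  then have "Sup ?S \<in> ?S" by (metis Max_in cSup_eq_Max)
  then obtain b' where b': "b' \<in> trunc_space n k"
    "kakeya_maximal n k \<phi> (coset_vec n k w)
      = (\<Sum>v\<in>trunc_line n k b' (coset_vec n k w). \<bar>\<phi> v\<bar>) / real CARD('a) ^ k"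
    unfolding kakeya_maximal_def lines_in_direction_def by auto
  then obtain b where b: "b' = coset_vec n k b" by (auto simp flip: coset_vec_image)
  have "lam * real CARD('a) ^ k \<le> (\<Sum>v\<in>trunc_line n k b' (coset_vec n k w). \<bar>\<phi> v\<bar>)"
    using assms b'(2) by (simp add: pos_le_divide_eq)
  \<comment> \<open>The line is a set, while the right side runs over parameters; the values are
    nonnegative, so repeated points can only increase it.\<close>
  also have "\<dots> \<le> (\<Sum>r\<in>trunc_fps k. \<bar>\<phi> (coset_vec n k (\<lambda>i\<in>{..<n}. fps_cutoff k (b i + r * w i)))\<bar>)"
    unfolding b trunc_line_eq
    using sum_image_le[of "trunc_fps k" "\<lambda>v. \<bar>\<phi> v\<bar>"
        "\<lambda>r. coset_vec n k (\<lambda>i\<in>{..<n}. fps_cutoff k (b i + r * w i))"]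
    by (simp add: finite_trunc_fps o_def)
  finally show ?thesis by blast
qed

theorem theorem3p3:
  fixes q n :: nat
  assumes "primepow q" and "CARD('a::{field,finite}) = q" and "n \<ge> 1"
  shows "\<exists>C::real. C > 0 \<and>
    (\<forall>k>0. \<forall>\<phi> :: (nat \<Rightarrow> 'a fps set) \<Rightarrow> real. \<forall>lam>0.
      real (card {w \<in> primitive_vectors n k. kakeya_maximal n k \<phi> w \<ge> lam})
        \<le> C * real k ^ (n + 1) * lam powi (- int n) * (\<Sum>v\<in>trunc_space n k. \<bar>\<phi> v\<bar> ^ n))"
proof (intro exI[of _ "(3 * real n) ^ n"] conjI allI impI)
  \<comment> \<open>The base \<open>3 * real n\<close> stems from
    \<open>2 * n * k + 1 <= 3 * n * k\<close> in the scaling of the weights.\<close>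
  show "0 < (3 * real n) ^ n" using assms(3) by simp
  fix k :: nat and \<phi> :: "(nat \<Rightarrow> 'a fps set) \<Rightarrow> real" and lam :: real
  assume k: "k > 0" and lam: "lam > 0"
  define S where "S = (\<Sum>v\<in>trunc_space n k. \<bar>\<phi> v\<bar> ^ n)"
  define Om where "Om = {w \<in> {..<n} \<rightarrow>\<^sub>E trunc_fps k. coset_vec n k w \<in> primitive_vectors n k
      \<and> kakeya_maximal n k \<phi> (coset_vec n k w) \<ge> lam}"
  have "{w \<in> primitive_vectors n k. kakeya_maximal n k \<phi> w \<ge> lam} \<subseteq> coset_vec n k ` Om"
  proof
    fix w assume w: "w \<in> {w \<in> primitive_vectors n k. kakeya_maximal n k \<phi> w \<ge> lam}"
    then have "w \<in> trunc_space n k" by (simp add: primitive_vectors_def)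
    then show "w \<in> coset_vec n k ` Om" using w by (auto simp: Om_def simp flip: coset_vec_image)
  qed
  moreover have "finite Om" by (simp add: Om_def finite_PiE finite_trunc_fps)
  ultimately have card: "card {w \<in> primitive_vectors n k. kakeya_maximal n k \<phi> w \<ge> lam} \<le> card Om"
    by (meson card_image_le card_mono finite_imageI order_trans)
  have "real (card Om) * lam ^ n \<le> (3 * real n * real k) ^ n *
      (\<Sum>v\<in>{..<n} \<rightarrow>\<^sub>E trunc_fps k. \<bar>\<phi> (coset_vec n k v)\<bar> ^ n)"
    by (rule truncated_maximal_bound)
       (use assms k lam primitive_vector_unit_coordinate kakeya_maximal_attained in \<open>auto simp: Om_def\<close>)
  also have "(\<Sum>v\<in>{..<n} \<rightarrow>\<^sub>E trunc_fps k. \<bar>\<phi> (coset_vec n k v)\<bar> ^ n) = S"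
    unfolding S_def coset_vec_image[symmetric] by (simp add: sum.reindex[OF inj_on_coset_vec])
  finally have "real (card Om) \<le> (3 * real n) ^ n * real k ^ n * S / lam ^ n"
    using lam by (simp add: pos_le_divide_eq power_mult_distrib)
  \<comment> \<open>The counting yields the exponent \<open>n\<close> of \<open>k\<close>; since
    \<open>k >= 1\<close>, it may be raised to the \<open>n + 1\<close> of the statement.\<close>
  also have "\<dots> \<le> (3 * real n) ^ n * real k ^ (n + 1) * S / lam ^ n"
    using k lam by (intro divide_right_mono mult_right_mono mult_left_mono power_increasing)
      (auto simp: S_def intro!: sum_nonneg)
  also have "\<dots> = (3 * real n) ^ n * real k ^ (n + 1) * lam powi (- int n) * S"
    by (simp add: power_int_minus field_simps)
  finally show "real (card {w \<in> primitive_vectors n k. kakeya_maximal n k \<phi> w \<ge> lam})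
        \<le> (3 * real n) ^ n * real k ^ (n + 1) * lam powi (- int n) * (\<Sum>v\<in>trunc_space n k. \<bar>\<phi> v\<bar> ^ n)"
    using card unfolding S_def by linarith
qed

end
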